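(* Let $T>0$ and let $\lambda$ be real analytic on $[0,T]$ (real-valued). Then the Loewner curve $\gamma$ generated by $\lambda$, parametrized by halfplane capacity, is real analytic on $(0,T]$.
   Context: Chordal Loewner equation: for a continuous real function $\lambda$ on $[0,T]$ and $z\in\mathbb{H}$, $g_t(z)$ solves $\partial_t g_t(z)=\frac{2}{g_t(z)-\lambda(t)}$, $g_0(z)=z$, up to $T_z=\inf\{t: g_t(z)=\lambda(t)\}$; $K_t=\{z\in\mathbb{H}:T_z\le t\}$; $g_t:\mathbb{H}\setminus K_t\to\mathbb{H}$ is conformal with $g_t(z)=z+\frac{2t}{z}+O(z^{-2})$ at $\infty$. $\lambda$ generates $\gamma:[0,T]\to\overline{\mathbb{H}}$ if for each $t$, $\mathbb{H}\setminus K_t$ is the unbounded component of $\mathbb{H}\setminus\gamma(0,t]$; then $\lambda(t)=g_t(\gamma(t))$ and $\gamma$ is parametrized by halfplane capacity. *)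

theory Defs
  imports "HOL-Analysis.Analysis"
begin

definition real_analytic_on :: "(real \<Rightarrow> 'a::real_normed_vector) \<Rightarrow> real set \<Rightarrow> bool" where
  "real_analytic_on f S \<longleftrightarrow>
     (\<forall>x\<in>S. \<exists>r>0. \<exists>c::nat \<Rightarrow> 'a.
        \<forall>y\<in>S. \<bar>y - x\<bar> < r \<longrightarrow> (\<lambda>n. ((y - x) ^ n) *\<^sub>R c n) sums f y)"

definition upper_half_plane :: "complex set" where
  "upper_half_plane = {z. Im z > 0}"

definition loewner_survives :: "(real \<Rightarrow> real) \<Rightarrow> complex \<Rightarrow> real \<Rightarrow> bool" where
  "loewner_survives lam z t \<longleftrightarrow>
     (\<exists>h :: real \<Rightarrow> complex. h 0 = z \<and>
        (\<forall>s\<in>{0..t}. h s \<noteq> complex_of_real (lam s) \<and>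
           (h has_vector_derivative (2 / (h s - complex_of_real (lam s)))) (at s within {0..t})))"

text \<open>Loewner hull K_t = {z in H : T_z \<le> t}.\<close>
definition loewner_hull :: "(real \<Rightarrow> real) \<Rightarrow> real \<Rightarrow> complex set" where
  "loewner_hull lam t = {z \<in> upper_half_plane. \<not> loewner_survives lam z t}"

definition loewner_generates :: "(real \<Rightarrow> real) \<Rightarrow> real \<Rightarrow> (real \<Rightarrow> complex) \<Rightarrow> bool" where
  "loewner_generates lam T \<gamma> \<longleftrightarrow>
     continuous_on {0..T} \<gamma> \<and> (\<forall>t\<in>{0..T}. Im (\<gamma> t) \<ge> 0) \<and>
     (\<forall>t\<in>{0..T}. \<exists>w \<in> upper_half_plane - \<gamma> ` {0<..t}.
        upper_half_plane - loewner_hull lam t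
          = connected_component_set (upper_half_plane - \<gamma> ` {0<..t}) w \<and>
        \<not> bounded (connected_component_set (upper_half_plane - \<gamma> ` {0<..t}) w))"

end

theory Submission
  imports Defs "HOL-Complex_Analysis.Complex_Analysis"
begin

text \<open>
  For every time t > 0 there is exactly one point z(t) of the half-plane whose Loewner flow hits the
  driving function at time t. Uniqueness: the displacements u = h - lam of two such flows are
  asymptotically vertical as they vanish, so Re (u v) < 0, which makes the distance of the two flows
  increase in time; but it tends to 0. If the curve missed z(t), a whole ball around z(t) would
  be swallowed at time t, contradicting uniqueness; hence \<gamma>(t) = z(t).

  Analyticity of z: pick a < t close to t and put b = sqrt (t - a). In the variable r defined by
  t - s = (b r)^2 the singular backward flow from the tip has displacement 2 i b r P(r, b), where
  P(r, b)^2 = 1 - 2 i b r \<integral> y^2 P(r y, b) lam'(a + b^2 (1 - r^2 y^2)) dy over 0 \<le> y \<le> 1.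
  This equation makes sense for complex b and is solved by a Picard iteration whose iterates are
  holomorphic in b, so the flow at time a depends holomorphically on b and therefore on t. The regular
  backward flow from time a to time 0 depends holomorphically on its starting point.
\<close>

section \<open>Loewner flows\<close>

text \<open>The Loewner vector field blows up at the tip, so the tip cannot serve as an initial
  value. The remedy is to square the displacement u = h - lam: the derivative of u^2 is 4 - 2 lam'
  u, which stays regular at u = 0. For constant lam this gives u = 2 i sqrt (t - s), which is the
  origin of the variable r and of the factor 2 i b r. Integrating the derivative of u^2 from s to t,
  where u vanishes, and dividing by -4 (b r)^2 produces the equation for P. The time a lies strictly
  before t because the construction is holomorphic in b = sqrt (t - a), and this yields holomorphy
  in t only away from the branch point b = 0. For complex b the time argument of lam' leaves the
  real axis, so lam' enters through its holomorphic extension. Existence of z(t) is a by-product of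
  this construction. Uniqueness is what ties the constructed points to \<gamma>, which is known only
  through components of complements.\<close>

definition loewner_flow :: "(real \<Rightarrow> real) \<Rightarrow> (real \<Rightarrow> complex) \<Rightarrow> real set \<Rightarrow> bool" where
  "loewner_flow lam h I \<longleftrightarrow>
     (\<forall>s\<in>I. h s \<noteq> complex_of_real (lam s) \<and>
        (h has_vector_derivative (2 / (h s - complex_of_real (lam s)))) (at s within I))"

lemma loewner_survives_iff:
  "loewner_survives lam z t \<longleftrightarrow> (\<exists>h. h 0 = z \<and> loewner_flow lam h {0..t})"
  by (simp add: loewner_survives_def loewner_flow_def)

lemma loewner_flow_subset: "loewner_flow lam h J \<Longrightarrow> I \<subseteq> J \<Longrightarrow> loewner_flow lam h I"
  unfolding loewner_flow_def by (blast intro: has_vector_derivative_within_subset)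

lemma loewner_flow_continuous: "loewner_flow lam h I \<Longrightarrow> continuous_on I h"
  unfolding loewner_flow_def continuous_on_eq_continuous_within
  by (blast intro: has_vector_derivative_continuous)

lemma loewner_flow_cong:
  assumes "loewner_flow lam h I" "\<And>s. s \<in> I \<Longrightarrow> k s = h s"
  shows "loewner_flow lam k I"
  using assms unfolding loewner_flow_def
  by (metis (no_types, lifting) has_vector_derivative_transform)

text \<open>Differentiability at s within \<open>{a..<t}\<close> is decided by times near s, so a
  closed interval ending midway between s and t suffices. Half-open time sets matter because they
  carry the flows that run into the singularity at t.\<close>

lemma loewner_flow_halfopen:
  assumes "\<And>s. a \<le> s \<Longrightarrow> s < t \<Longrightarrow> loewner_flow lam h {a..s}"
  shows "loewner_flow lam h {a..<t}"
  unfolding loewner_flow_def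
proof
  fix s assume s: "s \<in> {a..<t}"
  define m where "m = (s + t) / 2"
  have m: "s < m" "m < t" "a \<le> m" using s by (auto simp: m_def)
  have eq: "at s within {a..<t} = at s within {a..m}"
    by (rule at_within_nhd[where S = "{..<m}"]) (use m in auto)
  show "h s \<noteq> complex_of_real (lam s) \<and>
        (h has_vector_derivative 2 / (h s - complex_of_real (lam s))) (at s within {a..<t})"
    using assms[OF m(3,2)] s m unfolding eq loewner_flow_def by auto
qed

section \<open>Linear equations, uniqueness of flows, positivity of the imaginary part\<close>

lemma linear_ode_solution:
  fixes d c :: "real \<Rightarrow> 'a::{real_normed_field,banach}"
  assumes c: "continuous_on {a..b} c"
    and d: "\<And>x. x \<in> {a..b} \<Longrightarrow> (d has_vector_derivative c x * d x) (at x within {a..b})"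
    and x: "x \<in> {a..b}"
  shows "d x = exp (integral {a..x} c) * d a"
proof -
  define G where "G x = integral {a..x} c" for x
  define F where "F x = exp (- G x) * d x" for x
  have "(F has_vector_derivative 0) (at x within {a..b})" if "x \<in> {a..b}" for x
  proof -
    have "(G has_vector_derivative c x) (at x within {a..b})"
      unfolding G_def using integral_has_vector_derivative[OF c that] .
    then have "((\<lambda>x. - G x) has_vector_derivative - c x) (at x within {a..b})"
      by (rule has_vector_derivative_minus)
    moreover have "(exp has_field_derivative exp (- G x)) (at (- G x) within S)" for S
      by (simp add: DERIV_exp has_field_derivative_at_within)
    ultimately have "((\<lambda>x. exp (- G x)) has_vector_derivative - c x * exp (- G x)) (at x within {a..b})"
      using field_vector_diff_chain_within[of "\<lambda>x. - G x" "- c x" x "{a..b}" exp] by (simp add: o_def)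
    from has_vector_derivative_mult[OF this d[OF that]]
    show ?thesis by (simp add: F_def[abs_def] algebra_simps)
  qed
  then have "\<exists>k. \<forall>x\<in>{a..b}. F x = k"
    by (intro has_derivative_zero_constant) (auto simp: has_vector_derivative_def)
  moreover have "a \<in> {a..b}" using x by auto
  ultimately have "F x = F a" using x by metis
  then have "exp (- G x) * d x = d a" by (simp add: F_def G_def)
  then have "exp (G x) * (exp (- G x) * d x) = exp (G x) * d a" by simp
  then show ?thesis by (simp add: G_def mult.assoc[symmetric] exp_minus_inverse)
qed

text \<open>With displacements u and v, 2/u - 2/v = -2 (u - v) / (u v), so the difference of two
  flows solves a linear equation. Its exponential factor never vanishes, hence flows that agree at
  one time agree both earlier and later.\<close>

lemma loewner_flow_diff:
  assumes h: "loewner_flow lam h {a..b}" and k: "loewner_flow lam k {a..b}" and x: "x \<in> {a..b}"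
    and lam: "continuous_on {a..b} lam"
  shows "h x - k x = exp (integral {a..x} (\<lambda>s. - 2 / ((h s - lam s) * (k s - lam s)))) * (h a - k a)"
proof (rule linear_ode_solution[OF _ _ x])
  show "continuous_on {a..b} (\<lambda>s. - 2 / ((h s - lam s) * (k s - lam s)))"
    by (intro continuous_intros lam loewner_flow_continuous[OF h] loewner_flow_continuous[OF k])
      (use h k in \<open>auto simp: loewner_flow_def\<close>)
next
  fix s assume s: "s \<in> {a..b}"
  have ne: "h s - lam s \<noteq> 0" "k s - lam s \<noteq> 0" using s h k by (auto simp: loewner_flow_def)
  have "((\<lambda>s. h s - k s) has_vector_derivative (2 / (h s - lam s) - 2 / (k s - lam s))) (at s within {a..b})"
    using s h k by (intro has_vector_derivative_diff) (auto simp: loewner_flow_def)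
  moreover have "2 / (h s - lam s) - 2 / (k s - lam s) = - 2 / ((h s - lam s) * (k s - lam s)) * (h s - k s)"
    using ne by (simp add: divide_simps)
  ultimately show "((\<lambda>s. h s - k s) has_vector_derivative
      - 2 / ((h s - lam s) * (k s - lam s)) * (h s - k s)) (at s within {a..b})" by simp
qed

lemma loewner_flow_unique:
  assumes h: "loewner_flow lam h {a..b}" and k: "loewner_flow lam k {a..b}"
    and lam: "continuous_on {a..b} lam"
    and x: "x \<in> {a..b}" "h x = k x" and y: "y \<in> {a..b}"
  shows "h y = k y"
  using loewner_flow_diff[OF h k x(1) lam] loewner_flow_diff[OF h k y lam] x(2) by simp

lemma has_vector_derivative_Im:
  "(f has_vector_derivative d) F \<Longrightarrow> ((\<lambda>x. Im (f x)) has_vector_derivative Im d) F"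
  by (rule bounded_linear.has_vector_derivative[OF bounded_linear_Im])

lemma has_vector_derivative_Re:
  "(f has_vector_derivative d) F \<Longrightarrow> ((\<lambda>x. Re (f x)) has_vector_derivative Re d) F"
  by (rule bounded_linear.has_vector_derivative[OF bounded_linear_Re])

text \<open>Since lam is real, the imaginary part satisfies a linear equation with the real
  coefficient -2 / |h - lam|^2, so it keeps its sign as long as the flow exists.\<close>

lemma loewner_flow_Im_pos:
  assumes h: "loewner_flow lam h {a..b}" and lam: "continuous_on {a..b} lam"
    and "Im (h a) > 0" and x: "x \<in> {a..b}"
  shows "Im (h x) > 0"
proof -
  have ch: "continuous_on {a..b} h" by (rule loewner_flow_continuous[OF h])
  have "Im (h x) = exp (integral {a..x} (\<lambda>s. - 2 / (cmod (h s - lam s))\<^sup>2)) * Im (h a)"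
  proof (rule linear_ode_solution[OF _ _ x])
    show "continuous_on {a..b} (\<lambda>s. - 2 / (cmod (h s - lam s))\<^sup>2)"
      by (intro continuous_intros lam ch) (use h in \<open>auto simp: loewner_flow_def\<close>)
  next
    fix s assume s: "s \<in> {a..b}"
    have "((\<lambda>s. Im (h s)) has_vector_derivative Im (2 / (h s - lam s))) (at s within {a..b})"
      using s h by (intro has_vector_derivative_Im) (auto simp: loewner_flow_def)
    moreover have "Im (2 / (h s - lam s)) = - 2 / (cmod (h s - lam s))\<^sup>2 * Im (h s)"
      by (simp add: Im_divide cmod_power2)
    ultimately show "((\<lambda>s. Im (h s)) has_vector_derivative - 2 / (cmod (h s - lam s))\<^sup>2 * Im (h s))
        (at s within {a..b})" by simp
  qed
  then show ?thesis using assms by simp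
qed

section \<open>Flows that hit the driving function\<close>

lemma at_left_eq: "a < t \<Longrightarrow> at (t::real) within {a..<t} = at_left t"
  by (rule at_within_nhd[where S = "{a<..}"]) auto

lemma tendsto_of_real_left:
  assumes lam: "continuous_on {0..t} lam" and "0 < t"
  shows "((\<lambda>s. complex_of_real (lam s)) \<longlongrightarrow> lam t) (at_left t)"
proof (intro tendsto_of_real)
  have "(lam \<longlongrightarrow> lam t) (at t within {0..t})" using assms by (auto simp: continuous_on_def)
  then show "(lam \<longlongrightarrow> lam t) (at_left t)" using at_within_Icc_at_left[OF \<open>0 < t\<close>] by metis
qed

lemma nondecreasing_within:
  fixes f :: "real \<Rightarrow> real"
  assumes "\<And>x. x \<in> {a..b} \<Longrightarrow> (f has_vector_derivative f' x) (at x within {a..b})"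
    and "\<And>x. x \<in> {a..b} \<Longrightarrow> f' x \<ge> 0" and "a \<le> b"
  shows "f a \<le> f b"
proof (rule DERIV_nonneg_imp_increasing_open[OF \<open>a \<le> b\<close>])
  fix x assume "a < x" "x < b"
  then show "\<exists>y. DERIV f x :> y \<and> 0 \<le> y"
    using assms(1,2)[of x] by (auto simp: at_within_Icc_at has_real_derivative_iff_has_vector_derivative)
next
  show "continuous_on {a..b} f"
    unfolding continuous_on_eq_continuous_within
    using assms(1) has_vector_derivative_continuous by blast
qed

lemma vector_derivative_bound:
  fixes f :: "real \<Rightarrow> 'a::real_normed_vector"
  assumes "convex S" and f: "\<And>x. x \<in> S \<Longrightarrow> (f has_vector_derivative f' x) (at x within S)"
    and B: "\<And>x. x \<in> S \<Longrightarrow> norm (f' x) \<le> B" and "x \<in> S" "y \<in> S"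
  shows "norm (f x - f y) \<le> B * \<bar>x - y\<bar>"
proof -
  have "norm (f x - f y) \<le> B * norm (x - y)"
  proof (rule differentiable_bound[OF \<open>convex S\<close> _ _ \<open>x \<in> S\<close> \<open>y \<in> S\<close>])
    show "(f has_derivative (\<lambda>h. h *\<^sub>R f' x)) (at x within S)" if "x \<in> S" for x
      using f[OF that] by (simp add: has_vector_derivative_def)
    show "onorm (\<lambda>h. h *\<^sub>R f' x) \<le> B" if "x \<in> S" for x
      by (rule onorm_le) (use B[OF that] in \<open>auto simp: mult.commute[of B] intro: mult_left_mono\<close>)
  qed
  then show ?thesis by simp
qed

lemma tendsto_left_if_derivative_bounded:
  fixes f :: "real \<Rightarrow> 'a::banach"
  assumes "a < t" and f: "\<And>x. x \<in> {a..<t} \<Longrightarrow> (f has_vector_derivative f' x) (at x within {a..<t})"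
    and B: "\<And>x. x \<in> {a..<t} \<Longrightarrow> norm (f' x) \<le> B"
  obtains L where "(f \<longlongrightarrow> L) (at_left t)"
proof -
  have "0 \<le> norm (f' a)" "norm (f' a) \<le> B" using B[of a] \<open>a < t\<close> by auto
  then have "0 \<le> B" by linarith
  then have "B-lipschitz_on {a..<t} f"
    using vector_derivative_bound[OF _ f B] by (intro lipschitz_onI) (auto simp: dist_norm)
  then have "uniformly_continuous_on {a..<t} f"
    by (rule lipschitz_on_uniformly_continuous)
  moreover have "t \<in> closure {a..<t}" using \<open>a < t\<close> by simp
  ultimately obtain L where "(f \<longlongrightarrow> L) (at t within {a..<t})"
    by (rule uniformly_continuous_on_extension_at_closure)
  then show thesis using that at_left_eq[OF \<open>a < t\<close>] by metis
qed

text \<open>With u = h - lam one has u' = 2/u - l, and multiplying by 2 u cancels the pole. The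
  resulting right-hand side is bounded wherever u and l are, even at a collision; all the analysis
  near the tip rests on this.\<close>

lemma square_displacement_derivative:
  assumes "loewner_flow lam h I" "s \<in> I"
    and "((\<lambda>s. complex_of_real (lam s)) has_vector_derivative l) (at s within I)"
  shows "((\<lambda>s. (h s - lam s)\<^sup>2) has_vector_derivative 4 - 2 * l * (h s - lam s)) (at s within I)"
proof -
  have ne: "h s - lam s \<noteq> 0" and h: "(h has_vector_derivative 2 / (h s - lam s)) (at s within I)"
    using assms(1,2) by (auto simp: loewner_flow_def)
  have "((\<lambda>s. h s - lam s) has_vector_derivative 2 / (h s - lam s) - l) (at s within I)"
    by (rule has_vector_derivative_diff[OF h assms(3)])
  from has_vector_derivative_mult[OF this this]
  have "((\<lambda>s. (h s - lam s)\<^sup>2) has_vector_derivative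
      (h s - lam s) * (2 / (h s - lam s) - l) + (2 / (h s - lam s) - l) * (h s - lam s)) (at s within I)"
    by (simp add: power2_eq_square)
  moreover have "(h s - lam s) * (2 / (h s - lam s) - l) + (2 / (h s - lam s) - l) * (h s - lam s)
      = 4 - 2 * l * (h s - lam s)"
  proof -
    have "u * (2 / u - l) + (2 / u - l) * u = 4 - 2 * l * u" if "u \<noteq> 0" for u :: complex
      using that by (simp add: right_diff_distrib' left_diff_distrib)
    from this[OF ne] show ?thesis .
  qed
  ultimately show ?thesis by simp
qed

text \<open>A bootstrap: if m is the maximum of |h - lam| on \<open>{a..s}\<close>, the derivative
  of the squared displacement yields m^2 \<le> A + B m, which forces m \<le> A + B + 1. Neither
  \<open>A\<close> nor \<open>B\<close> depends on s, so the bound is uniform up to t.\<close>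

lemma displacement_bounded:
  assumes h: "loewner_flow lam h {a..<t}" and "a < t"
    and l: "\<And>s. s \<in> {a..<t} \<Longrightarrow>
      ((\<lambda>s. complex_of_real (lam s)) has_vector_derivative l s) (at s within {a..<t})"
    and M: "\<And>s. s \<in> {a..<t} \<Longrightarrow> cmod (l s) \<le> M"
  obtains K where "\<And>s. s \<in> {a..<t} \<Longrightarrow> cmod (h s - lam s) \<le> K"
proof
  define A where "A = (cmod (h a - lam a))\<^sup>2 + 4 * (t - a)"
  define B where "B = 2 * M * (t - a)"
  have "0 \<le> cmod (l a)" "cmod (l a) \<le> M" using M[of a] \<open>a < t\<close> by auto
  then have M0: "M \<ge> 0" by linarith
  have AB: "A \<ge> 0" "B \<ge> 0" using \<open>a < t\<close> M0 by (auto simp: A_def B_def)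
  fix s assume s: "s \<in> {a..<t}"
  have sub: "{a..s} \<subseteq> {a..<t}" using s by auto
  have "continuous_on {a..<t} (\<lambda>s. complex_of_real (lam s))"
    unfolding continuous_on_eq_continuous_within using l has_vector_derivative_continuous by blast
  then have "continuous_on {a..s} (\<lambda>s. cmod (h s - lam s))"
    using continuous_on_subset[OF _ sub] loewner_flow_continuous[OF h]
    by (intro continuous_on_norm continuous_on_diff)
  then obtain x where x: "x \<in> {a..s}" and max: "\<And>y. y \<in> {a..s} \<Longrightarrow> cmod (h y - lam y) \<le> cmod (h x - lam x)"
    using continuous_attains_sup[of "{a..s}" "\<lambda>s. cmod (h s - lam s)"] s by auto
  define m where "m = cmod (h x - lam x)"
  have "norm ((h x - lam x)\<^sup>2 - (h a - lam a)\<^sup>2) \<le> (4 + 2 * M * m) * \<bar>x - a\<bar>"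
  proof (rule vector_derivative_bound[where S = "{a..s}" and f' = "\<lambda>s. 4 - 2 * l s * (h s - lam s)"])
    fix y assume y: "y \<in> {a..s}"
    show "((\<lambda>s. (h s - lam s)\<^sup>2) has_vector_derivative 4 - 2 * l y * (h y - lam y)) (at y within {a..s})"
      using square_displacement_derivative[OF h _ l, of y] sub y has_vector_derivative_within_subset
      by blast
    have "cmod (l y) * cmod (h y - lam y) \<le> M * m"
      unfolding m_def using M[of y] max[OF y] y sub M0 by (intro mult_mono) auto
    then show "norm (4 - 2 * l y * (h y - lam y)) \<le> 4 + 2 * M * m"
      by (intro norm_triangle_le_diff) (simp add: norm_mult)
  qed (use x s in auto)
  also have "\<dots> \<le> (4 + 2 * M * m) * (t - a)"
    using x s M0 by (intro mult_left_mono) (auto simp: m_def)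
  finally have "m\<^sup>2 \<le> (cmod (h a - lam a))\<^sup>2 + (4 + 2 * M * m) * (t - a)"
    using norm_triangle_ineq2[of "(h x - lam x)\<^sup>2" "(h a - lam a)\<^sup>2"] by (simp add: norm_power m_def)
  then have m2: "m * m \<le> A + B * m"
    by (simp add: power2_eq_square A_def B_def algebra_simps)
  have "m \<le> A + B + 1"
  proof (rule ccontr)
    assume "\<not> m \<le> A + B + 1"
    then have m: "m > A + B + 1" by simp
    then have "(A + B + 1) * m \<le> m * m" using AB by (intro mult_right_mono) auto
    moreover have "A * 1 \<le> A * m" using m AB by (intro mult_left_mono) auto
    ultimately show False using m2 m AB by (simp add: algebra_simps)
  qed
  then show "cmod (h s - lam s) \<le> A + B + 1" using max[of s] s by (auto simp: m_def)
qed

text \<open>Survival up to each s < t provides a separate solution for every s. Uniqueness makes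
  them agree on common intervals, so the diagonal \<open>H s s\<close> is a single flow.\<close>

lemma survives_halfopen_flow:
  assumes "\<And>s. 0 \<le> s \<Longrightarrow> s < t \<Longrightarrow> loewner_survives lam z s" and lam: "continuous_on {0..<t} lam"
    and "0 < t"
  obtains h where "h 0 = z" "loewner_flow lam h {0..<t}"
proof -
  have "\<forall>s. \<exists>h. 0 \<le> s \<and> s < t \<longrightarrow> h 0 = z \<and> loewner_flow lam h {0..s}"
    using assms(1) unfolding loewner_survives_iff by blast
  then obtain H where H: "\<And>s. 0 \<le> s \<Longrightarrow> s < t \<Longrightarrow> H s 0 = z \<and> loewner_flow lam (H s) {0..s}"
    by metis
  define h where "h s = H s s" for s
  have eq: "h x = H s x" if "0 \<le> x" "x \<le> s" "s < t" for x s
    unfolding h_def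
  proof (rule loewner_flow_unique[where h = "H x" and k = "H s" and x = 0 and y = x and a = 0 and b = x])
    show "loewner_flow lam (H x) {0..x}" using H that by simp
    show "loewner_flow lam (H s) {0..x}" using H[of s] that by (auto intro: loewner_flow_subset)
    show "continuous_on {0..x} lam" using that by (auto intro: continuous_on_subset[OF lam])
    show "H x 0 = H s 0" using H[of x] H[of s] that by simp
  qed (use that in auto)
  show thesis
  proof
    show "h 0 = z" using H[of 0] \<open>0 < t\<close> by (simp add: h_def)
    show "loewner_flow lam h {0..<t}"
    proof (rule loewner_flow_halfopen)
      fix s assume "0 \<le> s" "s < t"
      then have "loewner_flow lam (H s) {0..s}" "\<And>x. x \<in> {0..s} \<Longrightarrow> h x = H s x"
        using H[of s] eq[of _ s] by simp_all
      then show "loewner_flow lam h {0..s}" by (rule loewner_flow_cong)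
    qed
  qed
qed

text \<open>Because L differs from lam t, the vector field along the extended path is continuous on
  the closed interval. The integral equation therefore passes to the limit s = t, and
  differentiating the indefinite integral gives the one-sided derivative there.\<close>

lemma loewner_flow_extend:
  assumes h: "loewner_flow lam h {a..<t}" and "a < t" and lam: "continuous_on {a..t} lam"
    and L: "(h \<longlongrightarrow> L) (at_left t)" "L \<noteq> lam t"
  shows "loewner_flow lam (h(t := L)) {a..t}"
proof -
  define k where "k = h(t := L)"
  define g where "g s = 2 / (k s - lam s)" for s
  have k: "k s = h s" if "s \<in> {a..<t}" for s using that by (auto simp: k_def)
  have kt: "k t = L" by (simp add: k_def)
  have contk: "continuous_on {a..t} k"
    unfolding continuous_on_eq_continuous_within
  proof
    fix x assume x: "x \<in> {a..t}"
    show "continuous (at x within {a..t}) k"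
    proof (cases "x = t")
      case True
      have "(k \<longlongrightarrow> L) (at_left t)"
        by (rule Lim_transform_eventually[OF L(1)]) (auto simp: eventually_at_left_field k_def intro!: exI[of _ a] \<open>a < t\<close>)
      moreover have "at t within {a..t} = at_left t" using \<open>a < t\<close> by (rule at_within_Icc_at_left)
      ultimately show ?thesis using True by (simp add: continuous_within kt)
    next
      case False
      then have x: "x \<in> {a..<t}" using x by auto
      have "continuous (at x within {a..<t}) k"
        using continuous_on_cong[THEN iffD2, OF refl _ loewner_flow_continuous[OF h], of k] k x
        unfolding continuous_on_eq_continuous_within by auto
      moreover have "at x within {a..<t} = at x within {a..t}"
        by (rule at_within_nhd[where S = "{..<t}"]) (use x in auto)
      ultimately show ?thesis by simp
    qed
  qed
  have ne: "k s \<noteq> lam s" if "s \<in> {a..t}" for s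
    using h L(2) k[of s] that kt by (cases "s = t") (auto simp: loewner_flow_def)
  have contg: "continuous_on {a..t} g"
    unfolding g_def by (intro continuous_intros contk lam) (use ne in auto)
  have int: "k s = h a + integral {a..s} g" if s: "s \<in> {a..<t}" for s
  proof -
    have "(g has_integral k s - k a) {a..s}"
    proof (rule fundamental_theorem_of_calculus)
      show "a \<le> s" using s by auto
      fix x assume x: "x \<in> {a..s}"
      have "(h has_vector_derivative g x) (at x within {a..s})"
        using h x s k[of x] unfolding loewner_flow_def g_def
        by (intro has_vector_derivative_within_subset[where S = "{a..<t}" and T = "{a..s}"]) auto
      then show "(k has_vector_derivative g x) (at x within {a..s})"
        by (rule has_vector_derivative_transform[rotated 2]) (use k x s in auto)
    qed
    then show ?thesis using k[of a] s by (auto simp: has_integral_iff)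
  qed
  have "((\<lambda>s. h a + integral {a..s} g) \<longlongrightarrow> h a + integral {a..t} g) (at t within {a..t})"
    using indefinite_integral_continuous_1[OF integrable_continuous_real[OF contg]] \<open>a < t\<close>
    by (intro tendsto_intros) (auto simp: continuous_on_def)
  then have 1: "((\<lambda>s. h a + integral {a..s} g) \<longlongrightarrow> h a + integral {a..t} g) (at_left t)"
    using at_within_Icc_at_left[OF \<open>a < t\<close>] by metis
  have "(h \<longlongrightarrow> h a + integral {a..t} g) (at_left t)"
  proof (rule Lim_transform_eventually[OF 1])
    show "\<forall>\<^sub>F s in at_left t. h a + integral {a..s} g = h s"
      unfolding eventually_at_left_field
    proof (intro exI[of _ a] conjI allI impI)
      fix s assume "a < s" "s < t"
      then have "s \<in> {a..<t}" by simp
      from int[OF this] k[OF this] show "h a + integral {a..s} g = h s" by simp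
    qed fact
  qed
  then have "L = h a + integral {a..t} g" by (intro tendsto_unique[OF _ L(1)]) auto
  then have int': "k s = h a + integral {a..s} g" if "s \<in> {a..t}" for s
    using int[of s] that kt by (cases "s = t") auto
  show ?thesis
    unfolding k_def[symmetric] loewner_flow_def
  proof (intro ballI conjI)
    fix s assume s: "s \<in> {a..t}"
    show "k s \<noteq> lam s" using ne s .
    have "((\<lambda>s. h a + integral {a..s} g) has_vector_derivative g s) (at s within {a..t})"
      using has_vector_derivative_add[OF has_vector_derivative_const integral_has_vector_derivative[OF contg s]]
      by simp
    then show "(k has_vector_derivative 2 / (k s - lam s)) (at s within {a..t})"
      unfolding g_def[symmetric] by (rule has_vector_derivative_transform[rotated 2]) (use s int' in auto)
  qed
qed

text \<open>
  The squared displacement has bounded derivative, hence a limit W. If W is nonzero, the vector field stays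
  bounded and the flow extends to time t.
\<close>
lemma swallowed_imp_hits:
  assumes h: "loewner_flow lam h {0..<t}" and a: "0 \<le> a" "a < t" and lam: "continuous_on {0..t} lam"
    and l: "\<And>s. s \<in> {a..t} \<Longrightarrow>
      ((\<lambda>s. complex_of_real (lam s)) has_vector_derivative l s) (at s within {a..t})"
    and M: "\<And>s. s \<in> {a..t} \<Longrightarrow> cmod (l s) \<le> M"
    and sw: "\<not> loewner_survives lam (h 0) t"
  shows "(h \<longlongrightarrow> lam t) (at_left t)"
proof (rule ccontr)
  assume contr: "\<not> (h \<longlongrightarrow> lam t) (at_left t)"
  have ha: "loewner_flow lam h {a..<t}" using a by (auto intro: loewner_flow_subset[OF h])
  have l': "((\<lambda>s. complex_of_real (lam s)) has_vector_derivative l s) (at s within {a..<t})"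
    if "s \<in> {a..<t}" for s
    using l that by (auto intro!: has_vector_derivative_within_subset[where S = "{a..t}" and T = "{a..<t}"])
  have M': "cmod (l s) \<le> M" if "s \<in> {a..<t}" for s using M that by auto
  have "0 \<le> cmod (l a)" "cmod (l a) \<le> M" using M[of a] a by auto
  then have M0: "M \<ge> 0" by linarith
  obtain K where K: "\<And>s. s \<in> {a..<t} \<Longrightarrow> cmod (h s - lam s) \<le> K"
    using displacement_bounded[OF ha a(2) l' M'] by metis
  define w where "w s = (h s - lam s)\<^sup>2" for s
  have "\<exists>W. (w \<longlongrightarrow> W) (at_left t)"
  proof (rule tendsto_left_if_derivative_bounded[OF a(2), of w "\<lambda>s. 4 - 2 * l s * (h s - lam s)" "4 + 2 * M * K"])
    fix s assume s: "s \<in> {a..<t}"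
    show "(w has_vector_derivative 4 - 2 * l s * (h s - lam s)) (at s within {a..<t})"
      unfolding w_def by (rule square_displacement_derivative[OF ha s l'[OF s]])
    have "cmod (l s) * cmod (h s - lam s) \<le> M * K"
      using M'[OF s] K[OF s] M0 by (intro mult_mono) auto
    then show "norm (4 - 2 * l s * (h s - lam s)) \<le> 4 + 2 * M * K"
      by (intro norm_triangle_le_diff) (simp add: norm_mult)
  qed blast
  then obtain W where W: "(w \<longlongrightarrow> W) (at_left t)" by blast
  have lamt: "((\<lambda>s. complex_of_real (lam s)) \<longlongrightarrow> lam t) (at_left t)"
    using a by (intro tendsto_of_real_left lam) auto
  have "W \<noteq> 0"
  proof
    assume "W = 0"
    then have "((\<lambda>s. sqrt (cmod (w s))) \<longlongrightarrow> sqrt (cmod 0)) (at_left t)"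
      using W by (intro tendsto_intros) auto
    then have "((\<lambda>s. cmod (h s - lam s)) \<longlongrightarrow> 0) (at_left t)"
      by (simp add: w_def norm_power)
    then have "((\<lambda>s. h s - lam s) \<longlongrightarrow> 0) (at_left t)" by (rule tendsto_norm_zero_cancel)
    from tendsto_add[OF this lamt] show False using contr by simp
  qed
  then have "\<forall>\<^sub>F s in at_left t. cmod (w s) > cmod W / 2"
    using tendsto_norm[OF W] by (intro order_tendstoD(1)) auto
  then obtain b where b: "b < t" "\<And>s. b < s \<Longrightarrow> s < t \<Longrightarrow> cmod (w s) > cmod W / 2"
    by (auto simp: eventually_at_left_field)
  define c where "c = (max a b + t) / 2"
  have c: "a < c" "b < c" "c < t" using a b by (auto simp: c_def max_def)
  have hc: "loewner_flow lam h {c..<t}" using c by (auto intro: loewner_flow_subset[OF ha])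
  define \<delta> where "\<delta> = sqrt (cmod W / 2)"
  have \<delta>: "\<delta> > 0" using \<open>W \<noteq> 0\<close> by (simp add: \<delta>_def)
  have lower: "cmod (h s - lam s) \<ge> \<delta>" if "s \<in> {c..<t}" for s
  proof -
    have "cmod W / 2 \<le> (cmod (h s - lam s))\<^sup>2" using b(2)[of s] that c by (simp add: w_def norm_power)
    then show ?thesis unfolding \<delta>_def by (intro real_le_lsqrt) auto
  qed
  have "\<exists>L. (h \<longlongrightarrow> L) (at_left t)"
  proof (rule tendsto_left_if_derivative_bounded[OF c(3), of h "\<lambda>s. 2 / (h s - lam s)" "2 / \<delta>"])
    fix s assume s: "s \<in> {c..<t}"
    show "(h has_vector_derivative 2 / (h s - lam s)) (at s within {c..<t})"
      using hc s by (auto simp: loewner_flow_def)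
    show "cmod (2 / (h s - lam s)) \<le> 2 / \<delta>"
      using lower[OF s] \<delta> by (simp add: norm_divide frac_le)
  qed blast
  then obtain L where L: "(h \<longlongrightarrow> L) (at_left t)" by blast
  have "L \<noteq> lam t" using L contr by auto
  then have "loewner_flow lam (h(t := L)) {0..t}"
    using a by (intro loewner_flow_extend[OF h _ lam L]) auto
  then have "loewner_survives lam (h 0) t"
    unfolding loewner_survives_iff using a by (intro exI[of _ "h(t := L)"]) auto
  then show False using sw by blast
qed

text \<open>The linear equation for the difference is singular at t, so
  \<open>loewner_flow_unique\<close> does not apply up to the collision. A sign argument near t
  replaces it: it shows agreement at some c < t, from which ordinary uniqueness carries the
  agreement back to time 0.\<close>

lemma hitting_flow_unique:
  assumes h: "loewner_flow lam h {0..<t}" and k: "loewner_flow lam k {0..<t}"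
    and Imh: "Im (h 0) > 0" and Imk: "Im (k 0) > 0"
    and a: "0 \<le> a" "a < t" and lam: "continuous_on {0..t} lam"
    and l: "\<And>s. s \<in> {a..t} \<Longrightarrow>
      ((\<lambda>s. complex_of_real (lam s)) has_vector_derivative l s) (at s within {a..t})"
    and M: "\<And>s. s \<in> {a..t} \<Longrightarrow> cmod (l s) \<le> M"
    and limh: "(h \<longlongrightarrow> lam t) (at_left t)" and limk: "(k \<longlongrightarrow> lam t) (at_left t)"
  shows "h 0 = k 0"
proof -
  have lamt: "((\<lambda>s. complex_of_real (lam s)) \<longlongrightarrow> lam t) (at_left t)"
    using a by (intro tendsto_of_real_left lam) auto
  \<comment> \<open>Asymptotic verticality in quantitative form: the real part of the squared
    displacement is strictly negative shortly before t, which says |Re| < |Im|; positivity of Im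
    then removes one absolute value.\<close>
  have steep: "\<exists>b. 0 \<le> b \<and> b < t \<and> (\<forall>s. b \<le> s \<and> s < t \<longrightarrow> Im (f s - lam s) > \<bar>Re (f s - lam s)\<bar>)"
    if f: "loewner_flow lam f {0..<t}" and Imf: "Im (f 0) > 0" and limf: "(f \<longlongrightarrow> lam t) (at_left t)" for f
  proof -
    \<comment> \<open>Once the displacement u is below 1/N, |2 l u| is at most 2, so Re (u^2) grows
      at rate at least 1. The summand 1 keeps \<open>N\<close> positive.\<close>
    define N where "N = \<bar>M\<bar> + 1"
    have N: "N > 0" by (simp add: N_def)
    have u0: "((\<lambda>s. f s - lam s) \<longlongrightarrow> 0) (at_left t)" using tendsto_diff[OF limf lamt] by simp
    then have "\<forall>\<^sub>F s in at_left t. cmod (f s - lam s) < 1 / N"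
      by (intro order_tendstoD(2)[of _ 0] tendsto_norm_zero) (auto simp: N_def)
    then obtain b where b: "b < t" "\<And>s. b < s \<Longrightarrow> s < t \<Longrightarrow> cmod (f s - lam s) < 1 / N"
      by (auto simp: eventually_at_left_field)
    define c where "c = (max a b + t) / 2"
    have c: "a < c" "b < c" "c < t" using a b by (auto simp: c_def max_def)
    have "Im (f s - lam s) > \<bar>Re (f s - lam s)\<bar>" if s: "c \<le> s" "s < t" for s
    proof -
      define w where "w s = Re ((f s - lam s)\<^sup>2)" for s
      have w': "(w has_vector_derivative Re (4 - 2 * l x * (f x - lam x))) (at x within {s..x'})"
        and pos: "Re (4 - 2 * l x * (f x - lam x)) \<ge> 1" if x: "x \<in> {s..x'}" "x' < t" for x x'
      proof -
        have sub: "{s..x'} \<subseteq> {a..t}" "{s..x'} \<subseteq> {0..<t}" using x c s a by auto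
        have fs: "loewner_flow lam f {s..x'}" using sub by (auto intro: loewner_flow_subset[OF f])
        have ls: "((\<lambda>s. complex_of_real (lam s)) has_vector_derivative l x) (at x within {s..x'})"
          using l[of x] x sub by (intro has_vector_derivative_within_subset[OF _ sub(1)]) auto
        show "(w has_vector_derivative Re (4 - 2 * l x * (f x - lam x))) (at x within {s..x'})"
          unfolding w_def
          by (intro has_vector_derivative_Re square_displacement_derivative[OF fs _ ls] x(1))
        have "cmod (2 * l x * (f x - lam x)) \<le> 2 * N * (1 / N)"
          unfolding norm_mult using M[of x] b(2)[of x] x c s sub
          by (intro mult_mono) (auto simp: N_def)
        also have "2 * N * (1 / N) = 2" using N by simp
        finally have "cmod (2 * l x * (f x - lam x)) \<le> 2" .
        then show "Re (4 - 2 * l x * (f x - lam x)) \<ge> 1"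
          using complex_Re_le_cmod[of "2 * l x * (f x - lam x)"] by simp
      qed
      \<comment> \<open>Letting x tend to t, where the displacement vanishes, turns this
        monotonicity into w s \<le> s - t < 0.\<close>
      have "w s - s \<le> w x - x" if "s \<le> x" "x < t" for x
      proof (rule nondecreasing_within[where f = "\<lambda>x. w x - x" and a = s and b = x and
              f' = "\<lambda>x. Re (4 - 2 * l x * (f x - lam x)) - 1"])
        fix y assume y: "y \<in> {s..x}"
        show "((\<lambda>s. w s - s) has_vector_derivative Re (4 - 2 * l y * (f y - lam y)) - 1) (at y within {s..x})"
          by (intro has_vector_derivative_diff w'[OF y \<open>x < t\<close>] has_vector_derivative_id)
        show "0 \<le> Re (4 - 2 * l y * (f y - lam y)) - 1" using pos[OF y \<open>x < t\<close>] by simp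
      qed fact
      then have "\<forall>\<^sub>F x in at_left t. w s - s \<le> w x - x"
        unfolding eventually_at_left_field using s by (intro exI[of _ s]) auto
      moreover have "((\<lambda>x. w x - x) \<longlongrightarrow> Re (0\<^sup>2) - t) (at_left t)"
        unfolding w_def by (intro tendsto_intros u0)
      ultimately have "w s - s \<le> Re (0\<^sup>2) - t" by (intro tendsto_lowerbound[where F = "at_left t"]) auto
      then have "w s < 0" using s by simp
      then have "(Re (f s - lam s))\<^sup>2 < (Im (f s - lam s))\<^sup>2" by (simp add: w_def Re_power2)
      moreover have "Im (f s) > 0"
        by (rule loewner_flow_Im_pos[of lam f 0 s])
          (use s c a Imf in \<open>auto intro: loewner_flow_subset[OF f] continuous_on_subset[OF lam]\<close>)
      ultimately show ?thesis by (auto simp: abs_le_square_iff[symmetric] not_le[symmetric])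
    qed
    then show ?thesis using c a by (intro exI[of _ c]) auto
  qed
  obtain b1 where b1: "0 \<le> b1" "b1 < t" "\<And>s. b1 \<le> s \<Longrightarrow> s < t \<Longrightarrow> Im (h s - lam s) > \<bar>Re (h s - lam s)\<bar>"
    using steep[OF h Imh limh] by blast
  obtain b2 where b2: "0 \<le> b2" "b2 < t" "\<And>s. b2 \<le> s \<Longrightarrow> s < t \<Longrightarrow> Im (k s - lam s) > \<bar>Re (k s - lam s)\<bar>"
    using steep[OF k Imk limk] by blast
  define c where "c = max b1 b2"
  have c: "0 \<le> c" "c < t" using b1 b2 by (auto simp: c_def)
  \<comment> \<open>The squared distance is differentiated as (h - k) times its conjugate, giving -4
    |h - k|^2 Re (1 / (p q)). The sign of Re (1 / (p q)) is that of Re (p q) = Re p Re q - Im p Im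
    q, which is nonpositive when both displacements are steep.\<close>
  have mono: "(cmod (h c - k c))\<^sup>2 \<le> (cmod (h x - k x))\<^sup>2" if x: "c \<le> x" "x < t" for x
  proof -
    have sub: "{c..x} \<subseteq> {0..<t}" using x c by auto
    have hs: "loewner_flow lam h {c..x}" and ks: "loewner_flow lam k {c..x}"
      using loewner_flow_subset[OF _ sub] h k by auto
    show ?thesis
    proof (rule nondecreasing_within[where f = "\<lambda>s. (cmod (h s - k s))\<^sup>2" and a = c and b = x and
          f' = "\<lambda>s. (cmod (h s - k s))\<^sup>2 * (- 4 * Re (1 / ((h s - lam s) * (k s - lam s))))"])
      fix s assume s: "s \<in> {c..x}"
      define p where "p = h s - lam s"
      define q where "q = k s - lam s"
      have ne: "p \<noteq> 0" "q \<noteq> 0" using hs ks s by (auto simp: loewner_flow_def p_def q_def)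
      have "((\<lambda>s. h s - k s) has_vector_derivative 2 / p - 2 / q) (at s within {c..x})"
        using hs ks s unfolding p_def q_def
        by (intro has_vector_derivative_diff) (auto simp: loewner_flow_def)
      moreover have "2 / p - 2 / q = - 2 * (h s - k s) * (1 / (p * q))"
        using ne by (simp add: divide_simps) (simp add: p_def q_def)
      ultimately have d: "((\<lambda>s. h s - k s) has_vector_derivative - 2 * (h s - k s) * (1 / (p * q))) (at s within {c..x})"
        by simp
      from has_vector_derivative_mult[OF d has_vector_derivative_cnj[OF d]]
      have "((\<lambda>s. Re ((h s - k s) * cnj (h s - k s))) has_vector_derivative
          Re ((h s - k s) * cnj (- 2 * (h s - k s) * (1 / (p * q))) + - 2 * (h s - k s) * (1 / (p * q)) * cnj (h s - k s))) (at s within {c..x})"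
        by (rule has_vector_derivative_Re)
      also have "Re ((h s - k s) * cnj (- 2 * (h s - k s) * (1 / (p * q))) + - 2 * (h s - k s) * (1 / (p * q)) * cnj (h s - k s))
         = (cmod (h s - k s))\<^sup>2 * (- 4 * Re (1 / (p * q)))"
      proof -
        have "Re (D * cnj (- 2 * D * c) + - 2 * D * c * cnj D) = (cmod D)\<^sup>2 * (- 4 * Re c)" for D c :: complex
          unfolding cmod_power2 by (cases D; cases c) (simp add: algebra_simps power2_eq_square)
        then show ?thesis .
      qed
      finally show "((\<lambda>s. (cmod (h s - k s))\<^sup>2) has_vector_derivative
          (cmod (h s - k s))\<^sup>2 * (- 4 * Re (1 / ((h s - lam s) * (k s - lam s))))) (at s within {c..x})"
        unfolding p_def q_def by (simp only: complex_norm_square[symmetric] Re_complex_of_real)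
      have "Im p > \<bar>Re p\<bar>" "Im q > \<bar>Re q\<bar>"
        using b1(3)[of s] b2(3)[of s] s x by (auto simp: p_def q_def c_def)
      then have "\<bar>Re p\<bar> * \<bar>Re q\<bar> \<le> Im p * Im q" by (intro mult_mono) auto
      then have "Re (p * q) \<le> 0" using abs_ge_self[of "Re p * Re q"] by (simp add: abs_mult)
      then have "Re (1 / (p * q)) \<le> 0" by (simp add: Re_divide' divide_nonpos_nonneg del: times_complex.sel)
      then have "0 \<le> - 4 * Re (1 / (p * q))" by simp
      then show "0 \<le> (cmod (h s - k s))\<^sup>2 * (- 4 * Re (1 / ((h s - lam s) * (k s - lam s))))"
        unfolding p_def q_def by (rule mult_nonneg_nonneg[OF zero_le_power2])
    qed fact
  qed
  have "((\<lambda>x. (cmod (h x - k x))\<^sup>2) \<longlongrightarrow> (cmod (complex_of_real (lam t) - complex_of_real (lam t)))\<^sup>2) (at_left t)"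
    by (intro tendsto_intros limh limk)
  moreover have "\<forall>\<^sub>F x in at_left t. (cmod (h c - k c))\<^sup>2 \<le> (cmod (h x - k x))\<^sup>2"
    unfolding eventually_at_left_field using c mono by (intro exI[of _ c]) auto
  ultimately have "(cmod (h c - k c))\<^sup>2 \<le> (cmod (complex_of_real (lam t) - complex_of_real (lam t)))\<^sup>2"
    by (rule tendsto_lowerbound) simp
  then have "h c = k c" by simp
  then show ?thesis
    by (rule loewner_flow_unique[where h = h and k = k and x = c and y = 0 and a = 0 and b = c, rotated 4])
      (use c in \<open>auto intro: loewner_flow_subset[OF h] loewner_flow_subset[OF k] continuous_on_subset[OF lam]\<close>)
qed

text \<open>The square of Im h decreases at rate 4 (Im h)^2 / |h - lam|^2, which is at most 4, and
  it tends to 0 at time t. The bound later controls the curve near time 0.\<close>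

lemma hitting_flow_Im_bound:
  assumes h: "loewner_flow lam h {0..<t}" and "0 < t" and lim: "(h \<longlongrightarrow> lam t) (at_left t)"
  shows "(Im (h 0))\<^sup>2 \<le> 4 * t"
proof -
  have "(Im (h 0))\<^sup>2 + 4 * 0 \<le> (Im (h x))\<^sup>2 + 4 * x" if x: "0 \<le> x" "x < t" for x
  proof -
    have hx: "loewner_flow lam h {0..x}" by (rule loewner_flow_subset[OF h]) (use x in auto)
    show ?thesis
    proof (rule nondecreasing_within[where f = "\<lambda>s. (Im (h s))\<^sup>2 + 4 * s" and a = 0 and b = x and
          f' = "\<lambda>s. 2 * Im (h s) * Im (2 / (h s - lam s)) + 4"])
      fix s assume s: "s \<in> {0..x}"
      have "((\<lambda>s. Im (h s)) has_vector_derivative Im (2 / (h s - lam s))) (at s within {0..x})"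
        using hx s by (intro has_vector_derivative_Im) (auto simp: loewner_flow_def)
      from has_vector_derivative_mult[OF this this]
      have 1: "((\<lambda>s. (Im (h s))\<^sup>2) has_vector_derivative 2 * Im (h s) * Im (2 / (h s - lam s))) (at s within {0..x})"
        by (simp add: power2_eq_square algebra_simps)
      have "((\<lambda>s. 4 * s) has_vector_derivative 4) (at s within {0..x})"
        by (auto simp: has_real_derivative_iff_has_vector_derivative[symmetric] intro!: derivative_eq_intros)
      from has_vector_derivative_add[OF 1 this]
      show "((\<lambda>s. (Im (h s))\<^sup>2 + 4 * s) has_vector_derivative 2 * Im (h s) * Im (2 / (h s - lam s)) + 4) (at s within {0..x})" .
      have "(Im (h s))\<^sup>2 \<le> (cmod (h s - lam s))\<^sup>2" by (simp add: cmod_power2)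
      then have "(Im (h s))\<^sup>2 / (cmod (h s - lam s))\<^sup>2 \<le> 1" by (simp add: divide_le_eq_1)
      then have "4 * ((Im (h s))\<^sup>2 / (cmod (h s - lam s))\<^sup>2) \<le> 4" by linarith
      then show "0 \<le> 2 * Im (h s) * Im (2 / (h s - lam s)) + 4"
        by (simp add: Im_divide cmod_power2) (simp add: power2_eq_square algebra_simps)
    qed fact
  qed
  then have "\<forall>\<^sub>F x in at_left t. (Im (h 0))\<^sup>2 \<le> (Im (h x))\<^sup>2 + 4 * x"
    unfolding eventually_at_left_field using \<open>0 < t\<close> by (intro exI[of _ 0]) auto
  moreover have "((\<lambda>x. (Im (h x))\<^sup>2 + 4 * x) \<longlongrightarrow> (Im (complex_of_real (lam t)))\<^sup>2 + 4 * t) (at_left t)"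
    by (intro tendsto_intros lim)
  ultimately show ?thesis using tendsto_lowerbound[where F = "at_left t"] by fastforce
qed

section \<open>Picard iteration with a holomorphic parameter\<close>

lemma contour_integral_linepath_eq:
  "contour_integral (linepath a b) f = integral {0..1} (\<lambda>x. f (linepath a b x) * (b - a))"
  unfolding contour_integral_integral vector_derivative_linepath_at ..

text \<open>Morera's theorem: joint continuity allows the integral over a triangle to be exchanged
  with the integral over y, and for each fixed y the triangle integral vanishes by Cauchy's
  theorem.\<close>

lemma holomorphic_on_integral_param:
  fixes f :: "complex \<Rightarrow> real \<Rightarrow> complex"
  assumes S: "open S" and cont: "continuous_on (S \<times> {a..b}) (\<lambda>(z, y). f z y)"
    and hol: "\<And>y. y \<in> {a..b} \<Longrightarrow> (\<lambda>z. f z y) holomorphic_on S"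
  shows "(\<lambda>z. integral {a..b} (f z)) holomorphic_on S"
proof -
  define F where "F z = integral {a..b} (f z)" for z
  have contF: "continuous_on S F"
    unfolding F_def using integral_continuous_on_param[of S a b f] cont by simp
  have line: "contour_integral (linepath p q) F
      = integral {a..b} (\<lambda>y. contour_integral (linepath p q) (\<lambda>z. f z y))"
    if pq: "closed_segment p q \<subseteq> S" for p q
  proof -
    have cont': "continuous_on (cbox (0, a) (1, b)) (\<lambda>(x, y). f (linepath p q x) y * (q - p))"
    proof -
      have "continuous_on ({0..1} \<times> {a..b}) ((\<lambda>(z, y). f z y) \<circ> (\<lambda>(x, y). (linepath p q x, y)))"
      proof (rule continuous_on_compose)
        show "continuous_on ({0..1} \<times> {a..b}) (\<lambda>(x, y). (linepath p q x, y))"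
          unfolding case_prod_unfold linepath_def by (intro continuous_intros)
        show "continuous_on ((\<lambda>(x, y). (linepath p q x, y)) ` ({0..1} \<times> {a..b})) (\<lambda>(z, y). f z y)"
          by (rule continuous_on_subset[OF cont]) (use pq in \<open>auto simp: linepath_in_path\<close>)
      qed
      then show ?thesis
        unfolding cbox_Pair_eq by (auto simp: case_prod_unfold o_def intro!: continuous_intros)
    qed
    have "contour_integral (linepath p q) F = integral {0..1} (\<lambda>x. integral {a..b} (\<lambda>y. f (linepath p q x) y * (q - p)))"
      unfolding contour_integral_linepath_eq F_def by simp
    also have "\<dots> = integral {a..b} (\<lambda>y. integral {0..1} (\<lambda>x. f (linepath p q x) y * (q - p)))"
      using integral_swap_continuous[OF cont'] by simp
    finally show ?thesis unfolding contour_integral_linepath_eq .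
  qed
  have sub: "closed_segment p q \<subseteq> S \<and> closed_segment q r \<subseteq> S \<and> closed_segment r p \<subseteq> S"
    if "convex hull {p, q, r} \<subseteq> S" for p q r
    using that by (meson segments_subset_convex_hull order_trans)
  have intg: "(\<lambda>y. contour_integral (linepath p q) (\<lambda>z. f z y)) integrable_on {a..b}"
    if pq: "closed_segment p q \<subseteq> S" for p q
  proof -
    have "continuous_on ({a..b} \<times> {0..1}) (\<lambda>(y, x). f (linepath p q x) y * (q - p))"
    proof -
      have "continuous_on ({a..b} \<times> {0..1}) ((\<lambda>(z, y). f z y) \<circ> (\<lambda>(y, x). (linepath p q x, y)))"
      proof (rule continuous_on_compose)
        show "continuous_on ({a..b} \<times> {0..1}) (\<lambda>(y, x). (linepath p q x, y))"
          unfolding case_prod_unfold linepath_def by (intro continuous_intros)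
        show "continuous_on ((\<lambda>(y, x). (linepath p q x, y)) ` ({a..b} \<times> {0..1})) (\<lambda>(z, y). f z y)"
          by (rule continuous_on_subset[OF cont]) (use pq in \<open>auto simp: linepath_in_path\<close>)
      qed
      then show ?thesis by (auto simp: case_prod_unfold o_def intro!: continuous_intros)
    qed
    then have "continuous_on {a..b} (\<lambda>y. integral (cbox 0 1) (\<lambda>x. f (linepath p q x) y * (q - p)))"
      by (intro integral_continuous_on_param) simp
    then show ?thesis unfolding contour_integral_linepath_eq by (intro integrable_continuous_real) simp
  qed
  have "F analytic_on S"
  proof (rule Morera_triangle[OF contF S], rule impI)
    fix p q r assume pqr: "convex hull {p, q, r} \<subseteq> S"
    note sub = sub[OF pqr]
    have "contour_integral (linepath p q) F + contour_integral (linepath q r) F + contour_integral (linepath r p) F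
      = integral {a..b} (\<lambda>y. contour_integral (linepath p q) (\<lambda>z. f z y)
          + contour_integral (linepath q r) (\<lambda>z. f z y) + contour_integral (linepath r p) (\<lambda>z. f z y))"
      using sub by (simp add: line integral_add integrable_add intg)
    also have "\<dots> = integral {a..b} (\<lambda>y. 0)"
    proof (rule integral_cong)
      fix y assume y: "y \<in> {a..b}"
      have hy: "(\<lambda>z. f z y) holomorphic_on S" by (rule hol[OF y])
      have "((\<lambda>z. f z y) has_contour_integral 0) (linepath p q +++ linepath q r +++ linepath r p)"
        by (rule Cauchy_theorem_triangle[OF holomorphic_on_subset[OF hy pqr]])
      moreover have "(\<lambda>z. f z y) contour_integrable_on (linepath u v)" if "closed_segment u v \<subseteq> S" for u v
        by (rule contour_integrable_continuous_linepath)
          (rule continuous_on_subset[OF holomorphic_on_imp_continuous_on[OF hy] that])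
      then have "((\<lambda>z. f z y) has_contour_integral contour_integral (linepath p q) (\<lambda>z. f z y)
          + (contour_integral (linepath q r) (\<lambda>z. f z y) + contour_integral (linepath r p) (\<lambda>z. f z y)))
          (linepath p q +++ linepath q r +++ linepath r p)"
        using sub by (intro has_contour_integral_join has_contour_integral_integral) auto
      ultimately show "contour_integral (linepath p q) (\<lambda>z. f z y)
          + contour_integral (linepath q r) (\<lambda>z. f z y) + contour_integral (linepath r p) (\<lambda>z. f z y) = 0"
        using has_contour_integral_unique by (simp only: add.assoc)
    qed
    finally show "contour_integral (linepath p q) F + contour_integral (linepath q r) F
        + contour_integral (linepath r p) F = 0" by simp
  qed
  then show ?thesis unfolding F_def by (rule analytic_imp_holomorphic)
qed

text \<open>The Picard operators below integrate over the fixed interval \<open>{0..1}\<close>,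
  which suits continuity and holomorphy in the parameters; this identity turns them back into
  indefinite integrals that can be differentiated. Working with the antiderivative \<open>G\<close>
  covers r = 0 as well.\<close>

lemma integral_scale_interval:
  fixes f :: "real \<Rightarrow> complex"
  assumes f: "continuous_on {0..r} f" and "0 \<le> r"
  shows "r * integral {0..1} (\<lambda>y. f (r * y)) = integral {0..r} f"
proof -
  define G where "G x = integral {0..x} f" for x
  have "((\<lambda>y. r *\<^sub>R f (r * y)) has_integral G (r * 1) - G (r * 0)) {0..1}"
  proof (rule fundamental_theorem_of_calculus)
    fix y :: real assume y: "y \<in> {0..1}"
    have ry: "r * y \<in> {0..r}" using y \<open>0 \<le> r\<close> by (auto simp: mult_left_le)
    have "(G has_vector_derivative f (r * y)) (at (r * y) within {0..r})"
      unfolding G_def by (rule integral_has_vector_derivative[OF f ry])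
    moreover have "(*) r ` {0..1} \<subseteq> {0..r}" using \<open>0 \<le> r\<close> by (auto simp: mult_left_le)
    ultimately have "(G has_vector_derivative f (r * y)) (at (r * y) within (*) r ` {0..1})"
      by (rule has_vector_derivative_within_subset)
    moreover have "((*) r has_vector_derivative r) (at y within {0..1})"
      unfolding has_real_derivative_iff_has_vector_derivative[symmetric]
      by (auto intro!: derivative_eq_intros)
    ultimately show "((\<lambda>y. G (r * y)) has_vector_derivative r *\<^sub>R f (r * y)) (at y within {0..1})"
      using vector_diff_chain_within[of "(*) r" r y "{0..1}" G "f (r * y)"] by (simp add: o_def)
  qed simp
  then have "integral {0..1} (\<lambda>y. r *\<^sub>R f (r * y)) = G r" by (subst integral_unique) (auto simp: G_def)
  then show ?thesis by (simp add: G_def scaleR_conv_of_real)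
qed

text \<open>The admissible functions of the iteration: r is the time-like variable, z the
  holomorphic parameter. Joint continuity is demanded because the integral operators need it, and
  the values are confined to \<open>D\<close>, where the integrands are under control.\<close>

definition holomorphic_family :: "real set \<Rightarrow> complex set \<Rightarrow> complex set \<Rightarrow> (real \<Rightarrow> complex \<Rightarrow> complex) \<Rightarrow> bool" where
  "holomorphic_family I S D W \<longleftrightarrow> continuous_on (I \<times> S) (\<lambda>(r, z). W r z) \<and>
     (\<forall>r\<in>I. W r holomorphic_on S) \<and> (\<forall>r\<in>I. \<forall>z\<in>S. W r z \<in> D)"

text \<open>Banach iteration in a sup norm weighted by \<omega>. The increments are dominated by a
  geometric series, so the iterates converge uniformly on I \<times> S; uniform limits preserve
  joint continuity, holomorphy in z and values in the closed set \<open>D\<close>. As the weight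
  lies between 1 and \<Omega>, weighted and plain estimates are interchangeable.\<close>

lemma picard_holomorphic_family:
  assumes S: "open S" and D: "closed D" and \<kappa>: "0 \<le> \<kappa>" "\<kappa> < 1"
    and \<omega>: "\<And>r. r \<in> I \<Longrightarrow> 1 \<le> \<omega> r \<and> \<omega> r \<le> \<Omega>"
    and W0: "holomorphic_family I S D W0"
    and \<Phi>: "\<And>W. holomorphic_family I S D W \<Longrightarrow> holomorphic_family I S D (\<Phi> W)"
    and contr: "\<And>W V C. holomorphic_family I S D W \<Longrightarrow> holomorphic_family I S D V \<Longrightarrow> 0 \<le> C \<Longrightarrow>
      (\<And>r z. r \<in> I \<Longrightarrow> z \<in> S \<Longrightarrow> cmod (W r z - V r z) \<le> C * \<omega> r) \<Longrightarrow>
      (\<And>r z. r \<in> I \<Longrightarrow> z \<in> S \<Longrightarrow> cmod (\<Phi> W r z - \<Phi> V r z) \<le> \<kappa> * C * \<omega> r)"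
    and C0: "\<And>r z. r \<in> I \<Longrightarrow> z \<in> S \<Longrightarrow> cmod (\<Phi> W0 r z - W0 r z) \<le> C0"
  obtains W where "holomorphic_family I S D W"
    and "\<And>r z. r \<in> I \<Longrightarrow> z \<in> S \<Longrightarrow> \<Phi> W r z = W r z"
proof -
  define X where "X n = (\<Phi> ^^ n) W0" for n
  have X0: "X 0 = W0" and XS: "X (Suc n) = \<Phi> (X n)" for n by (simp_all add: X_def)
  have fam: "holomorphic_family I S D (X n)" for n
    by (induction n) (auto simp: X0 XS W0 \<Phi>)
  \<comment> \<open>The absolute value supplies a nonnegative constant even when I \<times> S is
    empty.\<close>
  define C1 where "C1 = \<bar>C0\<bar>"
  have step: "cmod (X (Suc n) r z - X n r z) \<le> \<kappa> ^ n * C1 * \<omega> r" if "r \<in> I" "z \<in> S" for n r z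
    using that
  proof (induction n arbitrary: r z)
    case 0
    have "cmod (\<Phi> W0 r z - W0 r z) \<le> C1" using C0[OF 0] by (simp add: C1_def)
    also have "C1 \<le> C1 * \<omega> r" using \<omega>[OF 0(1)] by (simp add: C1_def mult_le_cancel_left1)
    finally show ?case by (simp add: X0 XS)
  next
    case (Suc n)
    have "cmod (\<Phi> (X (Suc n)) r z - \<Phi> (X n) r z) \<le> \<kappa> * (\<kappa> ^ n * C1) * \<omega> r"
      by (rule contr[OF fam fam _ Suc.IH Suc.prems]) (use \<kappa> in \<open>auto simp: C1_def\<close>)
    then show ?case by (simp add: XS mult.assoc)
  qed
  \<comment> \<open>The limit is written as a telescoping series, and on pairs rather than as a
    curried function, so that the Weierstrass test gives convergence uniformly in r and z
    together.\<close>
  define V where "V x = W0 (fst x) (snd x) + (\<Sum>n. X (Suc n) (fst x) (snd x) - X n (fst x) (snd x))" for x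
  have "uniform_limit (I \<times> S) (\<lambda>n x. \<Sum>i<n. X (Suc i) (fst x) (snd x) - X i (fst x) (snd x))
      (\<lambda>x. \<Sum>n. X (Suc n) (fst x) (snd x) - X n (fst x) (snd x)) sequentially"
  proof (rule Weierstrass_m_test)
    show "summable (\<lambda>n. \<kappa> ^ n * (C1 * \<Omega>))" using \<kappa> by (intro summable_mult2 summable_geometric) auto
    fix n and x assume x: "x \<in> I \<times> S"
    have "cmod (X (Suc n) (fst x) (snd x) - X n (fst x) (snd x)) \<le> \<kappa> ^ n * C1 * \<omega> (fst x)"
      using step x by auto
    also have "\<dots> \<le> \<kappa> ^ n * C1 * \<Omega>" using \<omega>[of "fst x"] x \<kappa> by (intro mult_left_mono) (auto simp: C1_def)
    finally show "cmod (X (Suc n) (fst x) (snd x) - X n (fst x) (snd x)) \<le> \<kappa> ^ n * (C1 * \<Omega>)"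
      by (simp add: mult.assoc)
  qed
  moreover have "(\<Sum>i<n. X (Suc i) r z - X i r z) = X n r z - W0 r z" for n r z
    using sum_lessThan_telescope[of "\<lambda>i. X i r z" n] by (simp add: X0)
  ultimately have "uniform_limit (I \<times> S) (\<lambda>n x. X n (fst x) (snd x) - W0 (fst x) (snd x))
      (\<lambda>x. \<Sum>n. X (Suc n) (fst x) (snd x) - X n (fst x) (snd x)) sequentially" by simp
  from uniform_limit_add[OF uniform_limit_const this, of "\<lambda>x. W0 (fst x) (snd x)"]
  have lim: "uniform_limit (I \<times> S) (\<lambda>n x. X n (fst x) (snd x)) V sequentially"
    by (simp add: V_def[abs_def])
  define W where "W r z = V (r, z)" for r z
  have ev: "\<forall>\<^sub>F n in sequentially. \<forall>r\<in>I. \<forall>z\<in>S. cmod (X n r z - W r z) < e" if "e > 0" for e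
    using uniform_limitD[OF lim that] by (simp add: W_def dist_norm)
  have ptw: "(\<lambda>n. X n r z) \<longlonglongrightarrow> W r z" if "r \<in> I" "z \<in> S" for r z
    using tendsto_uniform_limitI[OF lim, of "(r, z)"] that by (simp add: W_def)
  have famW: "holomorphic_family I S D W"
    unfolding holomorphic_family_def
  proof (intro conjI ballI)
    have "continuous_on (I \<times> S) V"
      by (rule uniform_limit_theorem[OF _ lim])
        (use fam in \<open>auto simp: holomorphic_family_def case_prod_unfold intro!: always_eventually\<close>)
    then show "continuous_on (I \<times> S) (\<lambda>(r, z). W r z)" by (simp add: W_def)
    fix r assume r: "r \<in> I"
    show "W r holomorphic_on S"
    proof (rule holomorphic_uniform_sequence[OF S, of "\<lambda>n. X n r"])
      show "X n r holomorphic_on S" for n using fam r by (auto simp: holomorphic_family_def)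
      fix x assume "x \<in> S"
      then obtain d where d: "d > 0" "cball x d \<subseteq> S" using S open_contains_cball by blast
      have "uniform_limit (cball x d) (\<lambda>n. X n r) (W r) sequentially"
      proof (rule uniform_limitI)
        fix e :: real assume "e > 0"
        from ev[OF this] show "\<forall>\<^sub>F n in sequentially. \<forall>z\<in>cball x d. dist (X n r z) (W r z) < e"
          by (rule eventually_mono) (use r d in \<open>auto simp: dist_norm\<close>)
      qed
      then show "\<exists>d>0. cball x d \<subseteq> S \<and> uniform_limit (cball x d) (\<lambda>n. X n r) (W r) sequentially"
        using d by blast
    qed
    fix z assume z: "z \<in> S"
    show "W r z \<in> D"
      by (rule Lim_in_closed_set[OF D _ _ ptw[OF r z]])
        (use fam r z in \<open>auto simp: holomorphic_family_def intro!: always_eventually\<close>)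
  qed
  have "\<Phi> W r z = W r z" if r: "r \<in> I" and z: "z \<in> S" for r z
  proof -
    have "cmod (\<Phi> W r z - W r z) \<le> 0 + e" if "e > 0" for e
    proof -
      \<comment> \<open>\<open>\<Phi> W\<close> and \<open>W\<close> are both compared with the
        iterate \<open>X (Suc n)\<close>; the two errors are at most \<epsilon> |\<Omega>| and
        \<epsilon>, which add up to e.\<close>
      define \<epsilon> where "\<epsilon> = e / (\<bar>\<Omega>\<bar> + 1)"
      have \<epsilon>: "\<epsilon> > 0" using \<open>e > 0\<close> by (simp add: \<epsilon>_def)
      obtain n where n: "\<And>m. m \<ge> n \<Longrightarrow> \<forall>r\<in>I. \<forall>z\<in>S. cmod (X m r z - W r z) < \<epsilon>"
        using ev[OF \<epsilon>] by (auto simp: eventually_sequentially)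
      have "cmod (\<Phi> (X n) r z - \<Phi> W r z) \<le> \<kappa> * \<epsilon> * \<omega> r"
      proof (rule contr[OF fam famW _ _ r z])
        show "0 \<le> \<epsilon>" using \<epsilon> by simp
        fix r z assume "r \<in> I" "z \<in> S"
        then have "cmod (X n r z - W r z) \<le> \<epsilon> * 1" using n[of n] by (auto intro: less_imp_le)
        also have "\<epsilon> * 1 \<le> \<epsilon> * \<omega> r" using \<epsilon> \<omega>[OF \<open>r \<in> I\<close>] by (intro mult_left_mono) auto
        finally show "cmod (X n r z - W r z) \<le> \<epsilon> * \<omega> r" .
      qed
      also have "\<kappa> * \<epsilon> * \<omega> r \<le> 1 * \<epsilon> * \<bar>\<Omega>\<bar>"
        using \<kappa> \<epsilon> \<omega>[OF r] by (intro mult_mono) auto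
      finally have 1: "cmod (X (Suc n) r z - \<Phi> W r z) \<le> \<epsilon> * \<bar>\<Omega>\<bar>" by (simp add: XS)
      have 2: "cmod (X (Suc n) r z - W r z) < \<epsilon>" using n[of "Suc n"] r z by auto
      have "cmod (\<Phi> W r z - W r z) \<le> cmod (X (Suc n) r z - \<Phi> W r z) + cmod (X (Suc n) r z - W r z)"
        using norm_triangle_ineq4[of "X (Suc n) r z - W r z" "X (Suc n) r z - \<Phi> W r z"] by simp
      also have "\<dots> \<le> \<epsilon> * (\<bar>\<Omega>\<bar> + 1)" using 1 2 by (simp add: algebra_simps)
      also have "\<dots> = e" by (simp add: \<epsilon>_def)
      finally show ?thesis by simp
    qed
    then have "cmod (\<Phi> W r z - W r z) \<le> 0" by (rule field_le_epsilon)
    then show ?thesis by simp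
  qed
  then show thesis using that famW by blast
qed

text \<open>Backward in time the imaginary part increases, so a flow that starts above height
  \<delta> stays at distance at least \<delta> from every real point. There the vector field is
  bounded and Lipschitz, and the solution reaches time 0 no matter how large a is.\<close>

lemma backward_flow:
  assumes lam: "continuous_on {0..a} lam" and "0 \<le> a" and \<delta>: "\<delta> > 0"
  obtains f where "f holomorphic_on {z. Im z > \<delta>}"
    and "\<And>z. Im z > \<delta> \<Longrightarrow> \<exists>h. loewner_flow lam h {0..a} \<and> h a = z \<and> h 0 = f z \<and> Im (f z) > 0"
proof -
  define S where "S = {z. Im z > \<delta>}"
  define D where "D = {z. Im z \<ge> \<delta>}"
  define I where "I = {0..a}"
  \<comment> \<open>\<open>W s z\<close> stands for the flow at time a - s that equals z at time a;
    the operator is the integral equation of the reversed flow, with its integral scaled to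
    \<open>{0..1}\<close>.\<close>
  define \<Phi> :: "(real \<Rightarrow> complex \<Rightarrow> complex) \<Rightarrow> real \<Rightarrow> complex \<Rightarrow> complex" where
    "\<Phi> W s z = z - 2 * s * integral {0..1} (\<lambda>y. 1 / (W (s * y) z - lam (a - s * y)))"
    for W :: "real \<Rightarrow> complex \<Rightarrow> complex" and s z
  \<comment> \<open>The weight exp (k s) makes the Picard operator a contraction on the whole time interval.\<close>
  define k where "k = 4 / \<delta>\<^sup>2"
  have k: "k > 0" using \<delta> by (simp add: k_def)
  have S: "open S" unfolding S_def by (rule open_halfspace_Im_gt)
  have D: "closed D" unfolding D_def by (rule closed_halfspace_Im_ge)
  have low: "cmod (w - of_real x) \<ge> \<delta>" if "w \<in> D" for w x
    using that abs_Im_le_cmod[of "w - of_real x"] by (auto simp: D_def)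
  have nz: "W r z \<noteq> complex_of_real x" if "holomorphic_family I S D W" "r \<in> I" "z \<in> S" for W r z x
  proof -
    have "W r z \<in> D" using that by (auto simp: holomorphic_family_def)
    from low[OF this, of x] show ?thesis using \<delta> by auto
  qed
  have scaled: "s * y \<in> I" "a - s * y \<in> I" if "s \<in> I" "y \<in> {0..1}" for s y
    using that mult_left_le[of y s] by (auto simp: I_def)
  have cont: "continuous_on ((I \<times> S) \<times> {0..1}) (\<lambda>(x, y). 1 / (W (fst x * y) (snd x) - lam (a - fst x * y)))"
    if W: "holomorphic_family I S D W" for W
  proof -
    have "continuous_on ((I \<times> S) \<times> {0..1}) ((\<lambda>(r, z). W r z) \<circ> (\<lambda>(x, y). (fst x * y, snd x)))"
    proof (rule continuous_on_compose)
      show "continuous_on ((I \<times> S) \<times> {0..1}) (\<lambda>(x, y). (fst x * y, snd x))"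
        unfolding case_prod_unfold by (intro continuous_intros)
      show "continuous_on ((\<lambda>(x, y). (fst x * y, snd x)) ` ((I \<times> S) \<times> {0..1})) (\<lambda>(r, z). W r z)"
        by (rule continuous_on_subset[of "I \<times> S"]) (use W in \<open>auto simp: holomorphic_family_def intro: scaled\<close>)
    qed
    moreover have "continuous_on ((I \<times> S) \<times> {0..1}) (lam \<circ> (\<lambda>(x, y). a - fst x * y))"
    proof (rule continuous_on_compose)
      show "continuous_on ((I \<times> S) \<times> {0..1}) (\<lambda>(x, y). a - fst x * y)"
        unfolding case_prod_unfold by (intro continuous_intros)
      show "continuous_on ((\<lambda>(x, y). a - fst x * y) ` ((I \<times> S) \<times> {0..1})) lam"
        by (rule continuous_on_subset[OF lam]) (auto simp: I_def[symmetric] intro: scaled)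
    qed
    ultimately show ?thesis
      unfolding case_prod_unfold o_def by (intro continuous_intros) (auto simp: nz[OF W] scaled)
  qed
  have cont1: "continuous_on {0..1} (\<lambda>y. 1 / (W (s * y) z - lam (a - s * y)))"
    if W: "holomorphic_family I S D W" and "s \<in> I" "z \<in> S" for W s z
  proof -
    have "continuous_on {0..1} ((\<lambda>(x, y). 1 / (W (fst x * y) (snd x) - lam (a - fst x * y))) \<circ> (\<lambda>y. ((s, z), y)))"
      by (rule continuous_on_compose[OF _ continuous_on_subset[OF cont[OF W]]])
        (use that in \<open>auto intro!: continuous_intros\<close>)
    then show ?thesis by (simp add: o_def)
  qed
  have fam: "holomorphic_family I S D (\<Phi> W)" if W: "holomorphic_family I S D W" for W
    unfolding holomorphic_family_def
  proof (intro conjI ballI)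
    have "continuous_on (I \<times> S) (\<lambda>x. integral (cbox 0 1) (\<lambda>y. 1 / (W (fst x * y) (snd x) - lam (a - fst x * y))))"
      by (rule integral_continuous_on_param) (use cont[OF W] in simp)
    then show "continuous_on (I \<times> S) (\<lambda>(s, z). \<Phi> W s z)"
      unfolding \<Phi>_def case_prod_unfold by (intro continuous_intros) simp
    fix s assume s: "s \<in> I"
    have "(\<lambda>z. integral {0..1} (\<lambda>y. 1 / (W (s * y) z - lam (a - s * y)))) holomorphic_on S"
    proof (rule holomorphic_on_integral_param[OF S])
      have "continuous_on (S \<times> {0..1}) ((\<lambda>(x, y). 1 / (W (fst x * y) (snd x) - lam (a - fst x * y))) \<circ> (\<lambda>(z, y). ((s, z), y)))"
        by (rule continuous_on_compose[OF _ continuous_on_subset[OF cont[OF W]]])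
          (use s in \<open>auto intro!: continuous_intros simp: case_prod_unfold\<close>)
      then show "continuous_on (S \<times> {0..1}) (\<lambda>(z, y). 1 / (W (s * y) z - lam (a - s * y)))"
        by (simp add: o_def case_prod_unfold)
      fix y :: real assume y: "y \<in> {0..1}"
      have "W (s * y) holomorphic_on S" using W scaled[OF s y] by (auto simp: holomorphic_family_def)
      then show "(\<lambda>z. 1 / (W (s * y) z - lam (a - s * y))) holomorphic_on S"
        by (intro holomorphic_intros) (auto simp: nz[OF W scaled(1)[OF s y]])
    qed
    then show "\<Phi> W s holomorphic_on S"
      unfolding \<Phi>_def[abs_def] by (intro holomorphic_intros)
    fix z assume z: "z \<in> S"
    have int: "(\<lambda>y. 1 / (W (s * y) z - lam (a - s * y))) integrable_on {0..1}"
      by (rule integrable_continuous_real[OF cont1[OF W s z]])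
    \<comment> \<open>For w in \<open>D\<close> and real x, 1 / (w - x) has nonpositive imaginary
      part. Subtracting a nonnegative multiple of its integral can only raise the imaginary part, so
      the operator does not leave \<open>D\<close>.\<close>
    have "Im (integral {0..1} (\<lambda>y. 1 / (W (s * y) z - lam (a - s * y))))
        = integral {0..1} (\<lambda>y. Im (1 / (W (s * y) z - lam (a - s * y))))"
      using integral_linear[OF int bounded_linear_Im] by (simp add: o_def)
    also have "\<dots> \<le> integral {0..1} (\<lambda>_::real. 0)"
    proof (rule integral_le)
      show "(\<lambda>y. Im (1 / (W (s * y) z - lam (a - s * y)))) integrable_on {0..1}"
        using integrable_linear[OF int bounded_linear_Im] by (simp add: o_def)
      fix y :: real assume y: "y \<in> {0..1}"
      have "W (s * y) z \<in> D" using W z scaled[OF s y] by (auto simp: holomorphic_family_def)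
      then show "Im (1 / (W (s * y) z - lam (a - s * y))) \<le> 0"
        using \<delta> by (simp add: Im_divide D_def divide_nonpos_nonneg)
    qed (rule integrable_0)
    finally have "Im (integral {0..1} (\<lambda>y. 1 / (W (s * y) z - lam (a - s * y)))) \<le> 0" by simp
    then have "s * Im (integral {0..1} (\<lambda>y. 1 / (W (s * y) z - lam (a - s * y)))) \<le> 0"
      using s by (auto simp: I_def intro: mult_nonneg_nonpos)
    then show "\<Phi> W s z \<in> D" using z by (simp add: \<Phi>_def D_def S_def)
  qed
  have famW0: "holomorphic_family I S D (\<lambda>s z. z)"
    by (auto simp: holomorphic_family_def S_def D_def case_prod_unfold intro!: continuous_intros)
  have contr: "cmod (\<Phi> W s z - \<Phi> V s z) \<le> 1 / 2 * C * exp (k * s)"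
    if W: "holomorphic_family I S D W" and V: "holomorphic_family I S D V" and "0 \<le> C"
      and C: "\<And>r z. r \<in> I \<Longrightarrow> z \<in> S \<Longrightarrow> cmod (W r z - V r z) \<le> C * exp (k * r)"
      and s: "s \<in> I" and z: "z \<in> S" for W V C s z
  proof -
    let ?w = "\<lambda>y. 1 / (W (s * y) z - lam (a - s * y))" and ?v = "\<lambda>y. 1 / (V (s * y) z - lam (a - s * y))"
    have intw: "?w integrable_on {0..1}" and intv: "?v integrable_on {0..1}"
      by (rule integrable_continuous_real[OF cont1[OF W s z]], rule integrable_continuous_real[OF cont1[OF V s z]])
    have "\<Phi> V s z - \<Phi> W s z = 2 * s * integral {0..1} (\<lambda>y. ?w y - ?v y)"
      unfolding \<Phi>_def by (subst integral_diff[OF intw intv]) (simp only: right_diff_distrib, simp)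
    also have "\<dots> = 2 * integral {0..1} (\<lambda>y. s *\<^sub>R (?w y - ?v y))"
      by (simp add: scaleR_conv_of_real)
    finally have "cmod (\<Phi> W s z - \<Phi> V s z) = 2 * cmod (integral {0..1} (\<lambda>y. s *\<^sub>R (?w y - ?v y)))"
      by (simp add: norm_minus_commute norm_mult)
    also have "\<dots> \<le> 2 * ((C / 4) * (exp (k * (s * 1)) - exp (k * (s * 0))))"
    proof (intro mult_left_mono)
      \<comment> \<open>On \<open>D\<close> the map w \<mapsto> 1 / (w - x) has Lipschitz constant
        1/\<delta>^2 = k/4. The integrand is thus dominated by C/4 times the derivative of exp (k s
        y) in y, and the prefactor 2 leaves the contraction constant 1/2.\<close>
      have *: "((\<lambda>y. (C / 4) * (s * k * exp (k * (s * y)))) has_integral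
          (C / 4) * (exp (k * (s * 1)) - exp (k * (s * 0)))) {0..1}"
      proof (intro has_integral_mult_right fundamental_theorem_of_calculus)
        show "((\<lambda>y. exp (k * (s * y))) has_vector_derivative s * k * exp (k * (s * y))) (at y within {0..1})" for y
          unfolding has_real_derivative_iff_has_vector_derivative[symmetric]
          by (auto intro!: derivative_eq_intros)
      qed simp
      have "cmod (integral {0..1} (\<lambda>y. s *\<^sub>R (?w y - ?v y))) \<le> integral {0..1} (\<lambda>y. (C / 4) * (s * k * exp (k * (s * y))))"
      proof (rule integral_norm_bound_integral)
        show "(\<lambda>y. s *\<^sub>R (?w y - ?v y)) integrable_on {0..1}"
          by (intro integrable_cmul integrable_diff intw intv)
        show "(\<lambda>y. (C / 4) * (s * k * exp (k * (s * y)))) integrable_on {0..1}" using * by blast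
        fix y :: real assume y: "y \<in> {0..1}"
        define p where "p = W (s * y) z - lam (a - s * y)"
        define q where "q = V (s * y) z - lam (a - s * y)"
        have pq: "cmod p \<ge> \<delta>" "cmod q \<ge> \<delta>"
          using low W V scaled[OF s y] z unfolding holomorphic_family_def p_def q_def by auto
        then have ne: "p \<noteq> 0" "q \<noteq> 0" using \<delta> by auto
        have "cmod (1 / p - 1 / q) = cmod (q - p) / (cmod p * cmod q)"
          using ne by (simp add: diff_divide_eq_iff divide_diff_eq_iff norm_divide norm_mult)
        also have "\<dots> \<le> cmod (q - p) / (\<delta> * \<delta>)"
          using pq \<delta> by (intro divide_left_mono mult_mono mult_pos_pos) auto
        also have "\<dots> \<le> (C * exp (k * (s * y))) / (\<delta> * \<delta>)"
          using C[OF scaled(1)[OF s y] z] \<delta>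
          by (intro divide_right_mono) (auto simp: p_def q_def norm_minus_commute)
        also have "\<dots> = (C / 4) * (k * exp (k * (s * y)))"
          by (simp add: k_def power2_eq_square)
        finally have "s * cmod (1 / p - 1 / q) \<le> s * ((C / 4) * (k * exp (k * (s * y))))"
          using s by (intro mult_left_mono) (auto simp: I_def)
        then show "cmod (s *\<^sub>R (?w y - ?v y)) \<le> (C / 4) * (s * k * exp (k * (s * y)))"
          using s unfolding p_def[symmetric] q_def[symmetric] by (simp add: I_def mult_ac)
      qed
      then show "cmod (integral {0..1} (\<lambda>y. s *\<^sub>R (?w y - ?v y))) \<le> (C / 4) * (exp (k * (s * 1)) - exp (k * (s * 0)))"
        using * by (simp only: integral_unique)
    qed simp
    also have "\<dots> \<le> 1 / 2 * C * exp (k * s)" using \<open>0 \<le> C\<close> by (simp add: algebra_simps)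
    finally show ?thesis .
  qed
  have C0: "cmod (\<Phi> (\<lambda>s z. z) s z - z) \<le> 2 * a / \<delta>" if s: "s \<in> I" and z: "z \<in> S" for s z
  proof -
    have "cmod (integral {0..1} (\<lambda>y. 1 / (z - lam (a - s * y)))) \<le> (1 / \<delta>) * (1 - 0)"
    proof (rule integral_bound)
      show "continuous_on {0..1} (\<lambda>y. 1 / (z - lam (a - s * y)))" using cont1[OF famW0 s z] .
      fix y :: real assume "y \<in> {0..1}"
      have "cmod (z - lam (a - s * y)) \<ge> \<delta>" using low[of z] z by (auto simp: D_def S_def)
      then show "cmod (1 / (z - lam (a - s * y))) \<le> 1 / \<delta>" using \<delta> by (simp add: norm_divide frac_le)
    qed simp
    then have "2 * s * cmod (integral {0..1} (\<lambda>y. 1 / (z - lam (a - s * y)))) \<le> 2 * a * (1 / \<delta>)"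
      using s \<delta> by (intro mult_mono) (auto simp: I_def)
    then show ?thesis using s by (simp add: \<Phi>_def norm_mult I_def)
  qed
  have \<omega>: "1 \<le> exp (k * s) \<and> exp (k * s) \<le> exp (k * a)" if "s \<in> I" for s
    using that k by (simp add: I_def)
  obtain W where W: "holomorphic_family I S D W" and fp: "\<And>r z. r \<in> I \<Longrightarrow> z \<in> S \<Longrightarrow> \<Phi> W r z = W r z"
    by (rule picard_holomorphic_family[where \<Phi> = \<Phi> and \<kappa> = "1 / 2", OF S D _ _ \<omega> famW0 fam contr C0]) auto
  show thesis
  proof (rule that[of "W a"])
    have aI: "a \<in> I" using \<open>0 \<le> a\<close> by (simp add: I_def)
    then show "W a holomorphic_on {z. Im z > \<delta>}" using W by (simp add: holomorphic_family_def S_def)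
    fix z assume "Im z > \<delta>"
    then have z: "z \<in> S" by (simp add: S_def)
    define g where "g x = 1 / (W x z - lam (a - x))" for x
    have inD: "W x z \<in> D" if "x \<in> I" for x using W z that by (auto simp: holomorphic_family_def)
    have ne: "W x z - lam (a - x) \<noteq> 0" if "x \<in> I" for x
      using low[OF inD[OF that], of "lam (a - x)"] \<delta> by auto
    have "continuous_on I ((\<lambda>(r, z). W r z) \<circ> (\<lambda>x. (x, z)))"
      using W z by (intro continuous_on_compose) (auto simp: holomorphic_family_def intro!: continuous_intros elim: continuous_on_subset)
    then have contW: "continuous_on I (\<lambda>x. W x z)" by (simp add: o_def)
    have contg: "continuous_on {0..a} g"
      unfolding g_def
    proof (intro continuous_intros)
      show "continuous_on {0..a} (\<lambda>x. W x z)" using contW by (simp add: I_def)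
      show "continuous_on {0..a} (\<lambda>x. lam (a - x))"
        by (rule continuous_on_compose2[OF lam]) (auto intro!: continuous_intros)
    qed (use ne in \<open>auto simp: I_def\<close>)
    have Weq: "W x z = z - 2 * integral {0..x} g" if "x \<in> {0..a}" for x
    proof -
      have "x * integral {0..1} (\<lambda>y. g (x * y)) = integral {0..x} g"
        by (rule integral_scale_interval) (use that in \<open>auto intro: continuous_on_subset[OF contg]\<close>)
      then show ?thesis using fp[of x z] that z by (simp add: \<Phi>_def g_def[abs_def] I_def mult.assoc)
    qed
    define h where "h t = W (a - t) z" for t
    have "loewner_flow lam h {0..a}"
      unfolding loewner_flow_def
    proof (intro ballI conjI)
      fix t assume t: "t \<in> {0..a}"
      then have at: "a - t \<in> {0..a}" by auto
      show "h t \<noteq> lam t" using ne[of "a - t"] at by (simp add: h_def I_def)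
      have "((\<lambda>x. z - 2 * integral {0..x} g) has_vector_derivative 0 - 2 * g (a - t)) (at (a - t) within {0..a})"
        by (intro has_vector_derivative_diff has_vector_derivative_const has_vector_derivative_mult_right
            integral_has_vector_derivative[OF contg at])
      then have "((\<lambda>x. z - 2 * integral {0..x} g) has_vector_derivative - 2 * g (a - t)) (at (a - t) within {0..a})"
        by simp
      then have 1: "((\<lambda>x. W x z) has_vector_derivative - 2 * g (a - t)) (at (a - t) within {0..a})"
        by (rule has_vector_derivative_transform[rotated 2]) (use at Weq in auto)
      have "(\<lambda>t. a - t) ` {0..a} \<subseteq> {0..a}" by auto
      from has_vector_derivative_within_subset[OF 1 this]
      have 2: "((\<lambda>x. W x z) has_vector_derivative - 2 * g (a - t)) (at (a - t) within (\<lambda>t. a - t) ` {0..a})" .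
      have "((\<lambda>t. a - t) has_vector_derivative - 1) (at t within {0..a})"
        unfolding has_real_derivative_iff_has_vector_derivative[symmetric]
        by (auto intro!: derivative_eq_intros)
      from vector_diff_chain_within[OF this 2]
      show "(h has_vector_derivative 2 / (h t - lam t)) (at t within {0..a})"
        by (simp add: o_def h_def[abs_def] g_def)
    qed
    moreover have "h a = z" using Weq[of 0] \<open>0 \<le> a\<close> by (simp add: h_def)
    moreover have "h 0 = W a z" by (simp add: h_def)
    moreover have "Im (W a z) > 0" using inD[OF aI] \<delta> by (simp add: D_def)
    ultimately show "\<exists>h. loewner_flow lam h {0..a} \<and> h a = z \<and> h 0 = W a z \<and> Im (W a z) > 0" by blast
  qed
qed

text \<open>\<open>F\<close> is the displacement at time a of the flow that collides at time a +
  b^2. It is fixed before b and \<open>lam\<close>, since it depends on the driving function only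
  through \<open>L\<close> and one holomorphic function must serve all real b. The bound \<beta>^2
  \<le> \<rho> keeps the complexified times in the domain of \<open>L\<close>, and \<beta> M \<le>
  1/4 makes the fixed point operator contract. The sign of 2 i b r selects the branch in the upper
  half-plane.\<close>

lemma local_hitting_flow:
  assumes L: "L holomorphic_on ball (complex_of_real a) \<rho>"
    and M: "\<And>z. z \<in> ball (complex_of_real a) \<rho> \<Longrightarrow> cmod (L z) \<le> M"
    and \<beta>: "0 < \<beta>" "\<beta>\<^sup>2 \<le> \<rho>" "\<beta> * M \<le> 1 / 4"
  obtains F where "F holomorphic_on ball 0 \<beta>"
    and "\<And>b lam. \<lbrakk>0 < b; b < \<beta>;
        \<forall>s\<in>{a..a + b\<^sup>2}. ((\<lambda>s. complex_of_real (lam s)) has_vector_derivative L (of_real s))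
          (at s within {a..a + b\<^sup>2})\<rbrakk> \<Longrightarrow>
      \<exists>h :: real \<Rightarrow> complex. loewner_flow lam h {a..<a + b\<^sup>2} \<and> (h \<longlongrightarrow> lam (a + b\<^sup>2)) (at_left (a + b\<^sup>2)) \<and>
        h a = lam a + F (of_real b) \<and> Im (F (of_real b)) \<ge> b"
proof -
  define S where "S = ball (0::complex) \<beta>"
  \<comment> \<open>Radius 1/2 keeps P = 1 - W in Re P \<ge> 1/2, away from zero. It is just
    preserved by the operator: |E| \<le> 3/4 and |W^2| \<le> 1/4 give (3/4 + 1/4) / 2 = 1/2.\<close>
  define D where "D = cball (0::complex) (1 / 2)"
  define I where "I = {0..1::real}"
  \<comment> \<open>With t = a + b^2 this is the time t - (b r y)^2; it is real for real b and stays
    within |b|^2 of a for complex b.\<close>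
  define A where "A r y b = complex_of_real a + b\<^sup>2 * (1 - of_real (r\<^sup>2 * y\<^sup>2))" for r y :: real and b
  define E :: "(real \<Rightarrow> complex \<Rightarrow> complex) \<Rightarrow> real \<Rightarrow> complex \<Rightarrow> complex" where
    "E W r b = 2 * \<i> * b * r * integral {0..1} (\<lambda>y. (complex_of_real y)\<^sup>2 * (1 - W (r * y) b) * L (A r y b))"
    for W :: "real \<Rightarrow> complex \<Rightarrow> complex" and r b
  \<comment> \<open>With P = 1 - W, the equation P^2 = 1 - E becomes the square-root-free fixed point W = (E + W^2) / 2.\<close>
  define \<Phi> where "\<Phi> W r b = (E W r b + (W r b)\<^sup>2) / 2" for W r b
  have "0 < \<rho>" using \<beta> by (metis less_le_trans zero_less_power)
  then have "complex_of_real a \<in> ball (complex_of_real a) \<rho>" by simp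
  from M[OF this] have M0: "M \<ge> 0" using norm_ge_zero order_trans by blast
  have S: "open S" and D: "closed D" by (simp_all add: S_def D_def)
  have scaled: "r * y \<in> I" if "r \<in> I" "y \<in> {0..1}" for r y
    using that mult_le_one[of r y] by (auto simp: I_def)
  have inA: "A r y b \<in> ball (complex_of_real a) \<rho>" if "r \<in> I" "y \<in> {0..1}" "b \<in> S" for r y b
  proof -
    have "(r * y)\<^sup>2 \<le> 1" using scaled[OF that(1,2)] by (simp add: I_def power_le_one)
    then have "\<bar>1 - r\<^sup>2 * y\<^sup>2\<bar> \<le> 1" by (simp add: power_mult_distrib abs_le_iff)
    have "cmod (b\<^sup>2 * of_real (1 - r\<^sup>2 * y\<^sup>2)) = (cmod b)\<^sup>2 * \<bar>1 - r\<^sup>2 * y\<^sup>2\<bar>"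
      by (simp only: norm_mult norm_power norm_of_real)
    also have "\<dots> \<le> (cmod b)\<^sup>2 * 1" using \<open>\<bar>1 - r\<^sup>2 * y\<^sup>2\<bar> \<le> 1\<close> by (intro mult_left_mono) auto
    also have "\<dots> < \<beta>\<^sup>2" using that(3) \<beta> by (auto simp: S_def intro!: power_strict_mono)
    finally show ?thesis using \<beta> by (simp add: A_def dist_norm norm_minus_commute)
  qed
  have contL: "continuous_on (ball (complex_of_real a) \<rho>) L"
    by (rule holomorphic_on_imp_continuous_on[OF L])
  have cont: "continuous_on ((I \<times> S) \<times> {0..1})
      (\<lambda>(x, y). (complex_of_real y)\<^sup>2 * (1 - W (fst x * y) (snd x)) * L (A (fst x) y (snd x)))"
    if W: "holomorphic_family I S D W" for W
  proof -
    have "continuous_on ((I \<times> S) \<times> {0..1}) ((\<lambda>(r, z). W r z) \<circ> (\<lambda>(x, y). (fst x * y, snd x)))"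
    proof (rule continuous_on_compose)
      show "continuous_on ((I \<times> S) \<times> {0..1}) (\<lambda>(x, y). (fst x * y, snd x))"
        unfolding case_prod_unfold by (intro continuous_intros)
      show "continuous_on ((\<lambda>(x, y). (fst x * y, snd x)) ` ((I \<times> S) \<times> {0..1})) (\<lambda>(r, z). W r z)"
        by (rule continuous_on_subset[of "I \<times> S"]) (use W in \<open>auto simp: holomorphic_family_def intro: scaled\<close>)
    qed
    moreover have "continuous_on ((I \<times> S) \<times> {0..1}) (L \<circ> (\<lambda>(x, y). A (fst x) y (snd x)))"
    proof (rule continuous_on_compose)
      show "continuous_on ((I \<times> S) \<times> {0..1}) (\<lambda>(x, y). A (fst x) y (snd x))"
        unfolding case_prod_unfold A_def by (intro continuous_intros)
      show "continuous_on ((\<lambda>(x, y). A (fst x) y (snd x)) ` ((I \<times> S) \<times> {0..1})) L"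
        by (rule continuous_on_subset[OF contL]) (use inA in auto)
    qed
    ultimately show ?thesis
      unfolding case_prod_unfold o_def by (intro continuous_intros) auto
  qed
  have cont1: "continuous_on {0..1} (\<lambda>y. (complex_of_real y)\<^sup>2 * (1 - W (r * y) b) * L (A r y b))"
    if W: "holomorphic_family I S D W" and "r \<in> I" "b \<in> S" for W r b
  proof -
    have "continuous_on {0..1} ((\<lambda>(x, y). (complex_of_real y)\<^sup>2 * (1 - W (fst x * y) (snd x)) * L (A (fst x) y (snd x))) \<circ> (\<lambda>y. ((r, b), y)))"
      by (rule continuous_on_compose[OF _ continuous_on_subset[OF cont[OF W]]])
        (use that in \<open>auto intro!: continuous_intros\<close>)
    then show ?thesis by (simp add: o_def)
  qed
  have small: "cmod b * M \<le> 1 / 4" if "b \<in> S" for b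
  proof -
    have "cmod b * M \<le> \<beta> * M" using that M0 by (intro mult_right_mono) (auto simp: S_def)
    then show ?thesis using \<beta> by simp
  qed
  have D_le: "cmod (W r b) \<le> 1 / 2" if "holomorphic_family I S D W" "r \<in> I" "b \<in> S" for W r b
    using that by (auto simp: holomorphic_family_def D_def)
  \<comment> \<open>All smallness enters here: |b| M \<le> 1/4 turns a bound K M on the integrand
    into K/2. It is applied with K = 3/2 to bound \<open>E\<close>, and with K = C to the difference
    of two values of \<open>E\<close>.\<close>
  have integral_le: "cmod (2 * \<i> * b * r * integral {0..1} f) \<le> K / 2"
    if f: "continuous_on {0..1} f" and K: "\<And>y. y \<in> {0..1} \<Longrightarrow> cmod (f y) \<le> K * M" and "0 \<le> K"
      and b: "b \<in> S" and r: "r \<in> I" for f :: "real \<Rightarrow> complex" and b r K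
  proof -
    have "cmod (integral {0..1} f) \<le> K * M * (1 - 0)"
      by (rule integral_bound[OF _ f K]) auto
    moreover have "cmod (2 * \<i> * b * r) \<le> 2 * cmod b"
      using r by (simp add: norm_mult I_def mult_left_le)
    ultimately have "cmod (2 * \<i> * b * r * integral {0..1} f) \<le> (2 * cmod b) * (K * M)"
      unfolding norm_mult[of _ "integral {0..1} f"] by (intro mult_mono) auto
    also have "\<dots> = 2 * K * (cmod b * M)" by simp
    also have "\<dots> \<le> 2 * K * (1 / 4)" using small[OF b] \<open>0 \<le> K\<close> by (intro mult_left_mono) auto
    finally show ?thesis by simp
  qed
  have y2: "cmod ((complex_of_real y)\<^sup>2 * p * q) \<le> cmod p * cmod q" if "y \<in> {0..1}" for y p q
  proof -
    have "y\<^sup>2 \<le> 1" using that by (simp add: power_le_one)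
    then have "y\<^sup>2 * (cmod p * cmod q) \<le> 1 * (cmod p * cmod q)" by (intro mult_right_mono) auto
    then show ?thesis by (simp add: norm_mult norm_power mult.assoc)
  qed
  have E_le: "cmod (E W r b) \<le> 3 / 4" if W: "holomorphic_family I S D W" and r: "r \<in> I" and b: "b \<in> S" for W r b
  proof -
    have "cmod (E W r b) \<le> (3 / 2) / 2"
      unfolding E_def
    proof (rule integral_le[OF cont1[OF W r b] _ _ b r])
      fix y :: real assume y: "y \<in> {0..1}"
      have "cmod ((complex_of_real y)\<^sup>2 * (1 - W (r * y) b) * L (A r y b)) \<le> cmod (1 - W (r * y) b) * cmod (L (A r y b))"
        by (rule y2[OF y])
      also have "\<dots> \<le> (3 / 2) * M"
        using norm_triangle_ineq4[of 1 "W (r * y) b"] D_le[OF W scaled[OF r y] b] M[OF inA[OF r y b]]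
        by (intro mult_mono) auto
      finally show "cmod ((complex_of_real y)\<^sup>2 * (1 - W (r * y) b) * L (A r y b)) \<le> (3 / 2) * M" .
    qed simp
    then show ?thesis by simp
  qed
  have fam: "holomorphic_family I S D (\<Phi> W)" if W: "holomorphic_family I S D W" for W
    unfolding holomorphic_family_def
  proof (intro conjI ballI)
    have "continuous_on (I \<times> S) (\<lambda>x. integral (cbox 0 1) (\<lambda>y. (complex_of_real y)\<^sup>2 * (1 - W (fst x * y) (snd x)) * L (A (fst x) y (snd x))))"
      by (rule integral_continuous_on_param) (use cont[OF W] in simp)
    moreover have "continuous_on (I \<times> S) (\<lambda>x. W (fst x) (snd x))"
      using W by (simp add: holomorphic_family_def case_prod_unfold)
    ultimately show "continuous_on (I \<times> S) (\<lambda>(s, z). \<Phi> W s z)"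
      unfolding \<Phi>_def E_def case_prod_unfold by (intro continuous_intros) simp_all
    fix r assume r: "r \<in> I"
    have "(\<lambda>b. integral {0..1} (\<lambda>y. (complex_of_real y)\<^sup>2 * (1 - W (r * y) b) * L (A r y b))) holomorphic_on S"
    proof (rule holomorphic_on_integral_param[OF S])
      have "continuous_on (S \<times> {0..1}) ((\<lambda>(x, y). (complex_of_real y)\<^sup>2 * (1 - W (fst x * y) (snd x)) * L (A (fst x) y (snd x))) \<circ> (\<lambda>(b, y). ((r, b), y)))"
        by (rule continuous_on_compose[OF _ continuous_on_subset[OF cont[OF W]]])
          (use r in \<open>auto intro!: continuous_intros simp: case_prod_unfold\<close>)
      then show "continuous_on (S \<times> {0..1}) (\<lambda>(b, y). (complex_of_real y)\<^sup>2 * (1 - W (r * y) b) * L (A r y b))"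
        by (simp add: o_def case_prod_unfold)
      fix y :: real assume y: "y \<in> {0..1}"
      have "W (r * y) holomorphic_on S" using W scaled[OF r y] by (auto simp: holomorphic_family_def)
      moreover have "(L \<circ> A r y) holomorphic_on S"
      proof (rule holomorphic_on_compose)
        show "A r y holomorphic_on S" unfolding A_def[abs_def] by (intro holomorphic_intros)
        show "L holomorphic_on A r y ` S" by (rule holomorphic_on_subset[OF L]) (use inA[OF r y] in auto)
      qed
      ultimately show "(\<lambda>b. (complex_of_real y)\<^sup>2 * (1 - W (r * y) b) * L (A r y b)) holomorphic_on S"
        unfolding o_def by (intro holomorphic_intros)
    qed
    moreover have "W r holomorphic_on S" using W r by (auto simp: holomorphic_family_def)
    ultimately show "\<Phi> W r holomorphic_on S"
      unfolding \<Phi>_def[abs_def] E_def by (intro holomorphic_intros) auto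
    fix b assume b: "b \<in> S"
    have "cmod ((W r b)\<^sup>2) \<le> (1 / 2)\<^sup>2" unfolding norm_power using D_le[OF W r b] by (intro power_mono) auto
    then have "cmod (E W r b + (W r b)\<^sup>2) \<le> 1"
      using E_le[OF W r b] by (intro norm_triangle_le) (simp add: power2_eq_square)
    then show "\<Phi> W r b \<in> D" by (simp add: \<Phi>_def D_def norm_divide)
  qed
  have contr: "cmod (\<Phi> W r b - \<Phi> V r b) \<le> 3 / 4 * C * 1"
    if W: "holomorphic_family I S D W" and V: "holomorphic_family I S D V" and "0 \<le> C"
      and C: "\<And>r b. r \<in> I \<Longrightarrow> b \<in> S \<Longrightarrow> cmod (W r b - V r b) \<le> C * 1"
      and r: "r \<in> I" and b: "b \<in> S" for W V C r b
  proof -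
    let ?w = "\<lambda>y. (complex_of_real y)\<^sup>2 * (1 - W (r * y) b) * L (A r y b)" and ?v = "\<lambda>y. (complex_of_real y)\<^sup>2 * (1 - V (r * y) b) * L (A r y b)"
    have intw: "?w integrable_on {0..1}" and intv: "?v integrable_on {0..1}"
      by (rule integrable_continuous_real[OF cont1[OF W r b]], rule integrable_continuous_real[OF cont1[OF V r b]])
    have "E W r b - E V r b = 2 * \<i> * b * r * integral {0..1} (\<lambda>y. ?w y - ?v y)"
      unfolding E_def by (subst integral_diff[OF intw intv]) (rule right_diff_distrib[symmetric])
    also have "cmod \<dots> \<le> C / 2"
    proof (rule integral_le[OF _ _ \<open>0 \<le> C\<close> b r])
      show "continuous_on {0..1} (\<lambda>y. ?w y - ?v y)"
        by (intro continuous_on_diff cont1 W V r b)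
      fix y :: real assume y: "y \<in> {0..1}"
      have "?w y - ?v y = (complex_of_real y)\<^sup>2 * (V (r * y) b - W (r * y) b) * L (A r y b)" by (simp add: algebra_simps)
      also have "cmod \<dots> \<le> cmod (V (r * y) b - W (r * y) b) * cmod (L (A r y b))" by (rule y2[OF y])
      also have "\<dots> \<le> C * M"
        using C[OF scaled[OF r y] b] M[OF inA[OF r y b]] \<open>0 \<le> C\<close>
        by (intro mult_mono) (auto simp: norm_minus_commute)
      finally show "cmod (?w y - ?v y) \<le> C * M" .
    qed
    finally have 1: "cmod (E W r b - E V r b) \<le> C / 2" .
    have "(W r b)\<^sup>2 - (V r b)\<^sup>2 = (W r b - V r b) * (W r b + V r b)"
      by (simp add: power2_eq_square algebra_simps)
    also have "cmod \<dots> \<le> C * 1"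
      unfolding norm_mult using C[OF r b] D_le[OF W r b] D_le[OF V r b] \<open>0 \<le> C\<close>
      by (intro mult_mono norm_triangle_le) auto
    finally have 2: "cmod ((W r b)\<^sup>2 - (V r b)\<^sup>2) \<le> C" by simp
    have "\<Phi> W r b - \<Phi> V r b = ((E W r b - E V r b) + ((W r b)\<^sup>2 - (V r b)\<^sup>2)) / 2"
      by (simp add: \<Phi>_def diff_divide_distrib[symmetric])
    also have "cmod \<dots> \<le> (C / 2 + C) / 2"
      unfolding norm_divide using 1 2 norm_triangle_le[of "E W r b - E V r b" "(W r b)\<^sup>2 - (V r b)\<^sup>2" "C / 2 + C"]
      by simp
    finally show ?thesis by simp
  qed
  have famW0: "holomorphic_family I S D (\<lambda>r b. 0)"
    by (auto simp: holomorphic_family_def D_def)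
  have C0: "cmod (\<Phi> (\<lambda>r b. 0) r b - 0) \<le> 1 / 2" if "r \<in> I" "b \<in> S" for r b
    using fam[OF famW0] that by (auto simp: holomorphic_family_def D_def)
  obtain W where W: "holomorphic_family I S D W" and fp: "\<And>r b. r \<in> I \<Longrightarrow> b \<in> S \<Longrightarrow> \<Phi> W r b = W r b"
    by (rule picard_holomorphic_family[where \<Phi> = \<Phi> and \<kappa> = "3 / 4" and \<omega> = "\<lambda>_. 1" and \<Omega> = 1,
          OF S D _ _ _ famW0 fam contr C0]) auto
  define P where "P r b = 1 - W r b" for r b
  have P2: "(P r b)\<^sup>2 = 1 - E W r b" if "r \<in> I" "b \<in> S" for r b
    using fp[OF that] by (simp add: P_def \<Phi>_def power2_eq_square algebra_simps)
  have RP: "Re (P r b) \<ge> 1 / 2" and NP: "cmod (P r b) \<le> 3 / 2" if "r \<in> I" "b \<in> S" for r b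
    using D_le[OF W that] complex_Re_le_cmod[of "W r b"] norm_triangle_ineq4[of 1 "W r b"] by (auto simp: P_def)
  show thesis
  proof (rule that[of "\<lambda>b. 2 * \<i> * b * P 1 b"])
    show "(\<lambda>b. 2 * \<i> * b * P 1 b) holomorphic_on ball 0 \<beta>"
      using W unfolding P_def holomorphic_family_def S_def I_def by (intro holomorphic_intros) auto
    fix b :: real and lam
    assume b: "0 < b" "b < \<beta>"
    define t where "t = a + b\<^sup>2"
    assume "\<forall>s\<in>{a..a + b\<^sup>2}. ((\<lambda>s. complex_of_real (lam s)) has_vector_derivative L (of_real s))
          (at s within {a..a + b\<^sup>2})"
    then have lam: "((\<lambda>s. complex_of_real (lam s)) has_vector_derivative L (of_real s)) (at s within {a..t})"
      if "s \<in> {a..t}" for s using that by (simp add: t_def)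
    define p where "p r = P r (of_real b)" for r
    have bS: "complex_of_real b \<in> S" using b by (simp add: S_def)
    have at: "a < t" using b by (simp add: t_def)
    define g where "g x = (complex_of_real x)\<^sup>2 * p x * L (of_real (t - b\<^sup>2 * x\<^sup>2))" for x
    have contg: "continuous_on {0..1} g"
    proof -
      have "continuous_on {0..1} ((\<lambda>(r, z). W r z) \<circ> (\<lambda>x. (x, complex_of_real b)))"
        by (rule continuous_on_compose[OF _ continuous_on_subset[of "I \<times> S"]])
          (use W bS in \<open>auto simp: holomorphic_family_def I_def intro!: continuous_intros\<close>)
      then have "continuous_on {0..1} p" unfolding p_def P_def by (simp add: o_def continuous_on_diff)
      moreover have "continuous_on {0..1} (\<lambda>x. L (of_real (t - b\<^sup>2 * x\<^sup>2)))"
      proof (rule continuous_on_compose2[OF contL])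
        show "continuous_on {0..1} (\<lambda>x. complex_of_real (t - b\<^sup>2 * x\<^sup>2))" by (intro continuous_intros)
        show "(\<lambda>x. complex_of_real (t - b\<^sup>2 * x\<^sup>2)) ` {0..1} \<subseteq> ball (complex_of_real a) \<rho>"
        proof safe
          fix x :: real assume "x \<in> {0..1}"
          with inA[of 1 x "of_real b"] bS show "complex_of_real (t - b\<^sup>2 * x\<^sup>2) \<in> ball (complex_of_real a) \<rho>"
            by (simp add: A_def I_def t_def algebra_simps)
        qed
      qed
      ultimately show ?thesis unfolding g_def by (intro continuous_intros)
    qed
    define K where "K r = integral {0..r} g" for r
    \<comment> \<open>The integrand of \<open>E\<close> carries y^2, that of \<open>K\<close> after
      rescaling carries (r y)^2; the factor r^2 makes up the difference. This frees \<open>E\<close>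
      from the scaled integral so that it can be differentiated in r.\<close>
    have rE: "r\<^sup>2 * E W r (of_real b) = 2 * \<i> * b * K r" if r: "r \<in> {0..1}" for r
    proof -
      have "K r = r * integral {0..1} (\<lambda>y. g (r * y))"
        unfolding K_def by (rule integral_scale_interval[symmetric]) (use r in \<open>auto intro: continuous_on_subset[OF contg]\<close>)
      also have "integral {0..1} (\<lambda>y. g (r * y))
          = integral {0..1} (\<lambda>y. r\<^sup>2 * ((complex_of_real y)\<^sup>2 * (1 - W (r * y) (of_real b)) * L (A r y (of_real b))))"
        by (rule integral_cong) (simp add: g_def p_def P_def A_def t_def power_mult_distrib algebra_simps)
      finally show ?thesis by (simp add: E_def power2_eq_square)
    qed
    define q where "q r = complex_of_real r * p r" for r
    define v where "v r = complex_of_real (r\<^sup>2) - 2 * \<i> * b * K r" for r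
    have q2: "(q r)\<^sup>2 = v r" if "r \<in> {0..1}" for r
    proof -
      have "(q r)\<^sup>2 = r\<^sup>2 * (1 - E W r (of_real b))"
        using P2[of r "of_real b"] that bS by (simp add: q_def p_def power_mult_distrib I_def)
      then show ?thesis using rE[OF that] by (simp add: v_def right_diff_distrib)
    qed
    have Req: "Re (q r) > 0" if "r \<in> {0<..1}" for r
      using RP[of r "of_real b"] that bS by (simp add: q_def p_def I_def)
    \<comment> \<open>The fixed point is only known to be continuous in r, so q = r P is
      differentiated through its square \<open>v\<close>, a polynomial minus an indefinite integral.
      Re q > 0 identifies q with the principal square root of \<open>v\<close> and keeps
      \<open>v\<close> off the branch cut; r = 0 is left out because q vanishes there.\<close>
    have dq: "(q has_vector_derivative r * (1 - \<i> * b * q r * L (of_real (t - b\<^sup>2 * r\<^sup>2))) / q r) (at r within {0<..1})"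
      if r: "r \<in> {0<..1}" for r
    proof -
      have r': "r \<in> {0..1}" using r by auto
      have "(K has_vector_derivative g r) (at r within {0..1})"
        unfolding K_def by (rule integral_has_vector_derivative[OF contg r'])
      moreover have "((\<lambda>r. complex_of_real (r\<^sup>2)) has_vector_derivative of_real (2 * r)) (at r within {0..1})"
        by (rule has_vector_derivative_of_real) (auto intro!: derivative_eq_intros)
      ultimately have "(v has_vector_derivative of_real (2 * r) - 2 * \<i> * b * g r) (at r within {0..1})"
        unfolding v_def[abs_def] by (intro has_vector_derivative_diff has_vector_derivative_mult_right)
      then have "(v has_vector_derivative of_real (2 * r) - 2 * \<i> * b * g r) (at r within {0<..1})"
        by (rule has_vector_derivative_within_subset) auto
      moreover have nz: "v r \<notin> \<real>\<^sub>\<le>\<^sub>0"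
        using Req[OF r] unfolding q2[OF r', symmetric] complex_nonpos_Reals_iff by (auto simp: Re_power2 Im_power2)
      have csq: "csqrt (v x) = q x" if "x \<in> {0<..1}" for x
        using Req[OF that] q2[of x] that csqrt_square[of "q x"] by auto
      from nz have "(csqrt has_field_derivative 1 / (2 * q r)) (at (v r) within v ` {0<..1})"
        using has_field_derivative_at_within[OF has_field_derivative_csqrt[OF nz]] csq[OF r] by (simp add: divide_simps)
      ultimately have "((csqrt \<circ> v) has_vector_derivative (of_real (2 * r) - 2 * \<i> * b * g r) * (1 / (2 * q r))) (at r within {0<..1})"
        by (rule field_vector_diff_chain_within)
      moreover have "(of_real (2 * r) - 2 * \<i> * b * g r) * (1 / (2 * q r))
          = r * (1 - \<i> * b * q r * L (of_real (t - b\<^sup>2 * r\<^sup>2))) / q r"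
        by (simp add: g_def q_def power2_eq_square divide_simps) (simp add: algebra_simps)
      ultimately show ?thesis
        by (intro has_vector_derivative_transform[of r "{0<..1}" q "csqrt \<circ> v"]) (use r csq in \<open>auto simp: o_def\<close>)
    qed
    \<comment> \<open>The inverse of the substitution t - s = (b r)^2: time a corresponds to r = 1,
      and s \<rightarrow> t to r \<rightarrow> 0.\<close>
    define R where "R s = sqrt (t - s) / b" for s
    have R: "R s \<in> {0<..1}" and R2: "b\<^sup>2 * (R s)\<^sup>2 = t - s" if "s \<in> {a..<t}" for s
    proof -
      have "sqrt (t - s) \<le> b" using that b by (intro real_le_lsqrt) (auto simp: t_def)
      then show "R s \<in> {0<..1}" using that b by (simp add: R_def)
      show "b\<^sup>2 * (R s)\<^sup>2 = t - s" using that b by (simp add: R_def power_divide)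
    qed
    define h where "h s = lam s + 2 * \<i> * b * q (R s)" for s
    have "loewner_flow lam h {a..<t}"
      unfolding loewner_flow_def
    proof (intro ballI conjI)
      fix s assume s: "s \<in> {a..<t}"
      have qn: "q (R s) \<noteq> 0" using Req[OF R[OF s]] by auto
      show "h s \<noteq> lam s" using qn b by (simp add: h_def)
      have "(R has_vector_derivative - 1 / (2 * b\<^sup>2 * R s)) (at s within {a..<t})"
        unfolding R_def[abs_def] has_real_derivative_iff_has_vector_derivative[symmetric] using s b
        by (auto intro!: derivative_eq_intros simp: field_simps power2_eq_square)
      moreover have "(q has_vector_derivative R s * (1 - \<i> * b * q (R s) * L (of_real s)) / q (R s)) (at (R s) within R ` {a..<t})"
        using dq[OF R[OF s]] R2[OF s] R
        by (intro has_vector_derivative_within_subset[where S = "{0<..1}" and T = "R ` {a..<t}"]) auto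
      ultimately have 1: "((q \<circ> R) has_vector_derivative (- 1 / (2 * b\<^sup>2 * R s)) *\<^sub>R (R s * (1 - \<i> * b * q (R s) * L (of_real s)) / q (R s))) (at s within {a..<t})"
        by (rule vector_diff_chain_within)
      have "((\<lambda>s. complex_of_real (lam s)) has_vector_derivative L (of_real s)) (at s within {a..<t})"
        by (rule has_vector_derivative_within_subset[OF lam[of s]]) (use s in auto)
      from has_vector_derivative_add[OF this has_vector_derivative_mult_right[OF 1, of "2 * \<i> * b"]]
      have 2: "(h has_vector_derivative L (of_real s) + 2 * \<i> * b *
          ((- 1 / (2 * b\<^sup>2 * R s)) *\<^sub>R (R s * (1 - \<i> * b * q (R s) * L (of_real s)) / q (R s)))) (at s within {a..<t})"
        by (simp add: h_def[abs_def] o_def)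
      have "l + 2 * \<i> * of_real b * ((- 1 / (2 * b\<^sup>2 * x)) *\<^sub>R (of_real x * (1 - \<i> * of_real b * k * l) / k)) = 2 / (2 * \<i> * of_real b * k)"
        if "x \<noteq> 0" "k \<noteq> 0" for l k :: complex and x
        using that b by (simp add: scaleR_conv_of_real field_simps power2_eq_square)
      from this[of "R s" "q (R s)" "L (of_real s)"] 2
      show "(h has_vector_derivative 2 / (h s - lam s)) (at s within {a..<t})"
        using R[OF s] qn by (simp add: h_def)
    qed
    moreover have "(h \<longlongrightarrow> lam t) (at_left t)"
    proof -
      have "continuous (at t within {a..t}) (\<lambda>s. complex_of_real (lam s))"
        using lam[of t] at has_vector_derivative_continuous by auto
      then have lamt: "((\<lambda>s. complex_of_real (lam s)) \<longlongrightarrow> lam t) (at_left t)"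
        using at_within_Icc_at_left[OF at] by (simp add: continuous_within)
      have "((\<lambda>s. 3 * sqrt (t - s)) \<longlongrightarrow> 3 * sqrt (t - t)) (at_left t)"
        by (intro tendsto_intros)
      then have lim0: "((\<lambda>s. 3 * sqrt (t - s)) \<longlongrightarrow> 0) (at_left t)" by simp
      \<comment> \<open>The constant 3 is 2 times the bound 3/2 on |P|, since b \<open>R s\<close> =
        sqrt (t - s).\<close>
      have "\<forall>\<^sub>F s in at_left t. cmod (2 * \<i> * b * q (R s)) \<le> 3 * sqrt (t - s)"
        unfolding eventually_at_left_field
      proof (intro exI[of _ a] conjI allI impI at)
        fix s assume "a < s" "s < t"
        then have s: "s \<in> {a..<t}" by auto
        have "cmod (2 * \<i> * b * q (R s)) = 2 * b * R s * cmod (p (R s))"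
          using b R[OF s] by (simp add: norm_mult q_def)
        also have "\<dots> \<le> 2 * b * R s * (3 / 2)"
          using NP[of "R s" "of_real b"] R[OF s] bS b by (intro mult_left_mono) (auto simp: p_def I_def)
        also have "\<dots> = 3 * sqrt (t - s)" using b by (simp add: R_def)
        finally show "cmod (2 * \<i> * b * q (R s)) \<le> 3 * sqrt (t - s)" .
      qed
      then have "((\<lambda>s. 2 * \<i> * b * q (R s)) \<longlongrightarrow> 0) (at_left t)"
        by (rule Lim_null_comparison[OF _ lim0])
      from tendsto_add[OF lamt this] show ?thesis by (simp add: h_def[abs_def])
    qed
    moreover have "h a = lam a + 2 * \<i> * b * P 1 (of_real b)"
      using b by (simp add: h_def R_def t_def q_def p_def)
    moreover have "Im (2 * \<i> * b * P 1 (of_real b)) \<ge> b"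
      using RP[of 1 "of_real b"] bS b by (simp add: I_def)
    ultimately show "\<exists>h :: real \<Rightarrow> complex. loewner_flow lam h {a..<a + b\<^sup>2} \<and> (h \<longlongrightarrow> lam (a + b\<^sup>2)) (at_left (a + b\<^sup>2)) \<and>
        h a = lam a + 2 * \<i> * of_real b * P 1 (of_real b) \<and> Im (2 * \<i> * of_real b * P 1 (of_real b)) \<ge> b"
      unfolding t_def[symmetric] by blast
  qed
qed

section \<open>The hitting points and the curve\<close>

lemma loewner_flow_glue:
  assumes h: "loewner_flow lam h {c..a}" and k: "loewner_flow lam k {a..<t}"
    and "h a = k a" "c \<le> a" "a < t"
  shows "loewner_flow lam (\<lambda>s. if s \<in> {c..a} then h s else k s) {c..<t}"
  unfolding loewner_flow_def
proof (intro ballI conjI)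
  fix s assume s: "s \<in> {c..<t}"
  have cl: "closure {c..a} \<inter> closure {a<..<t} = {a}" using \<open>a < t\<close> \<open>c \<le> a\<close> by auto
  have T: "{a<..<t} \<union> {a} = {a..<t}" "{c..a} \<union> {a} = {c..a}" using \<open>a < t\<close> \<open>c \<le> a\<close> by auto
  show "(if s \<in> {c..a} then h s else k s) \<noteq> lam s"
    using h k s by (auto simp: loewner_flow_def)
  have "((\<lambda>s. if s \<in> {c..a} then h s else k s) has_vector_derivative
      (if s \<in> {c..a} then 2 / (h s - lam s) else 2 / (k s - lam s))) (at s within {c..<t})"
  proof (rule has_vector_derivative_If_within_closures[where T = "{a<..<t}"], unfold cl T)
    show "s \<in> {c..a} \<union> {a<..<t}" "{c..<t} = {c..a} \<union> {a<..<t}" using s assms by auto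
    show "(h has_vector_derivative 2 / (h s - lam s)) (at s within {c..a})" if "s \<in> {c..a}"
      using h that by (auto simp: loewner_flow_def)
    show "(k has_vector_derivative 2 / (k s - lam s)) (at s within {a..<t})" if "s \<in> {a..<t}"
      using k that by (auto simp: loewner_flow_def)
    assume "s \<in> closure {c..a}" "s \<in> closure {a<..<t}"
    then have "s = a" using cl by blast
    then show "h s = k s" "2 / (h s - lam s) = 2 / (k s - lam s)" using \<open>h a = k a\<close> by auto
  qed
  then show "((\<lambda>s. if s \<in> {c..a} then h s else k s) has_vector_derivative
      2 / ((if s \<in> {c..a} then h s else k s) - lam s)) (at s within {c..<t})"
    by (cases "s \<in> {c..a}") (simp_all del: atLeastAtMost_iff)
qed

text \<open>A power series that converges at one real point at distance x from t0 converges in the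
  whole complex disc of radius x, so one-sided information at an endpoint of \<open>{0..T}\<close>
  is enough. The final radius is halved so that \<open>L\<close> is bounded by compactness.\<close>

lemma real_analytic_derivative_extension:
  assumes "T > 0" and lam: "real_analytic_on lam {0..T}" and t0: "t0 \<in> {0..T}"
  obtains R L M where "R > 0" "L holomorphic_on ball (complex_of_real t0) R"
    and "\<And>z. z \<in> ball (complex_of_real t0) R \<Longrightarrow> cmod (L z) \<le> M"
    and "\<And>J s. \<lbrakk>J \<subseteq> {0..T}; s \<in> J; \<bar>s - t0\<bar> < R\<rbrakk> \<Longrightarrow>
      ((\<lambda>s. complex_of_real (lam s)) has_vector_derivative L (of_real s)) (at s within J)"
proof -
  obtain r c where r: "r > 0" and c: "\<And>y. y \<in> {0..T} \<Longrightarrow> \<bar>y - t0\<bar> < r \<Longrightarrow> (\<lambda>n. ((y - t0) ^ n) *\<^sub>R c n) sums lam y"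
    using lam t0 unfolding real_analytic_on_def by blast
  \<comment> \<open>The cap T/2 guarantees that t0 - x or t0 + x lies in \<open>{0..T}\<close> for
    every x < R0, which supplies the real point of convergence.\<close>
  define R0 where "R0 = min r (T / 2)"
  have R0: "R0 > 0" using r \<open>T > 0\<close> by (simp add: R0_def)
  define \<Lambda> where "\<Lambda> z = (\<Sum>n. complex_of_real (c n) * (z - of_real t0) ^ n)" for z
  have sums: "(\<lambda>n. complex_of_real (c n) * (z - of_real t0) ^ n) sums \<Lambda> z" if z: "z \<in> ball (of_real t0) R0" for z
  proof -
    obtain x where x: "cmod (z - of_real t0) < x" "x < R0"
      using z dense by (auto simp: dist_norm norm_minus_commute)
    then have "0 < x" using norm_ge_zero[of "z - of_real t0"] by linarith
    define y where "y = (if t0 \<ge> T / 2 then t0 - x else t0 + x)"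
    have y: "y \<in> {0..T}" "\<bar>y - t0\<bar> = x" using x t0 \<open>0 < x\<close> by (auto simp: y_def R0_def)
    have "summable (\<lambda>n. c n * (y - t0) ^ n)"
      using c[of y] y x by (auto simp: sums_iff R0_def mult.commute)
    then have "summable (\<lambda>n. complex_of_real (c n * (y - t0) ^ n))" by (rule summable_of_real)
    then have "summable (\<lambda>n. complex_of_real (c n) * of_real (y - t0) ^ n)" by simp
    then have "summable (\<lambda>n. cmod (complex_of_real (c n) * (z - of_real t0) ^ n))"
      by (rule powser_insidea) (use x y in \<open>simp only: norm_of_real\<close>)
    then show ?thesis unfolding \<Lambda>_def by (rule summable_sums[OF summable_norm_cancel])
  qed
  then have hol: "\<Lambda> holomorphic_on ball (of_real t0) R0" by (rule power_series_holomorphic)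
  have eq: "\<Lambda> (of_real s) = of_real (lam s)" if "s \<in> {0..T}" "\<bar>s - t0\<bar> < R0" for s
  proof -
    have "(\<lambda>n. (s - t0) ^ n * c n) sums lam s" using c[of s] that by (simp add: R0_def)
    then have "(\<lambda>n. complex_of_real ((s - t0) ^ n * c n)) sums of_real (lam s)" by (simp only: sums_of_real)
    moreover have "complex_of_real s \<in> ball (of_real t0) R0"
      using that by (simp add: dist_norm norm_minus_commute flip: of_real_diff)
    ultimately show ?thesis using sums_unique2[OF sums] by (simp add: mult.commute)
  qed
  define L where "L = deriv \<Lambda>"
  have holL: "L holomorphic_on ball (of_real t0) R0"
    unfolding L_def by (rule holomorphic_deriv[OF hol]) simp
  have sub: "cball (complex_of_real t0) (R0 / 2) \<subseteq> ball (complex_of_real t0) R0" using R0 by auto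
  have "compact (L ` cball (of_real t0) (R0 / 2))"
    by (intro compact_continuous_image continuous_on_subset[OF holomorphic_on_imp_continuous_on[OF holL] sub]) simp
  then obtain M where M: "\<And>z. z \<in> cball (of_real t0) (R0 / 2) \<Longrightarrow> cmod (L z) \<le> M"
    using compact_imp_bounded bounded_iff by (metis imageI)
  show thesis
  proof (rule that[of "R0 / 2" L M])
    show "L holomorphic_on ball (of_real t0) (R0 / 2)"
      by (rule holomorphic_on_subset[OF holL]) (use sub in auto)
    show "cmod (L z) \<le> M" if "z \<in> ball (of_real t0) (R0 / 2)" for z using M that by auto
    fix J s assume J: "J \<subseteq> {0..T}" "s \<in> J" "\<bar>s - t0\<bar> < R0 / 2"
    have "complex_of_real s \<in> ball (of_real t0) R0"
    proof -
      have "\<bar>t0 - s\<bar> < R0" using J(3) R0 by linarith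
      then show ?thesis by (simp add: dist_norm flip: of_real_diff)
    qed
    then have "(\<Lambda> has_field_derivative L (of_real s)) (at (of_real s))"
      unfolding L_def by (intro holomorphic_derivI[OF hol]) auto
    then have "((\<lambda>s. \<Lambda> (of_real s)) has_vector_derivative L (of_real s)) (at s within J)"
      by (rule has_vector_derivative_real_field)
    then show "((\<lambda>s. complex_of_real (lam s)) has_vector_derivative L (of_real s)) (at s within J)"
    proof (rule has_vector_derivative_transform_within)
      show "0 < R0 / 2" "s \<in> J" using R0 J by auto
      fix x assume "x \<in> J" "dist x s < R0 / 2"
      then have "\<bar>x - t0\<bar> < R0" using J(3) unfolding dist_real_def by linarith
      then show "\<Lambda> (of_real x) = of_real (lam x)" using J \<open>x \<in> J\<close> by (intro eq) auto
    qed
  qed (use R0 in simp)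
qed

lemma real_analytic_imp_continuous:
  fixes lam :: "real \<Rightarrow> real"
  assumes "T > 0" and lam: "real_analytic_on lam {0..T}"
  shows "continuous_on {0..T} lam"
  unfolding continuous_on_eq_continuous_within
proof
  fix t0 assume t0: "t0 \<in> {0..T}"
  obtain R L M where "R > 0" and "L holomorphic_on ball (complex_of_real t0) R"
    and "\<And>z. z \<in> ball (complex_of_real t0) R \<Longrightarrow> cmod (L z) \<le> M"
    and d: "\<And>J s. \<lbrakk>J \<subseteq> {0..T}; s \<in> J; \<bar>s - t0\<bar> < R\<rbrakk> \<Longrightarrow>
      ((\<lambda>s. complex_of_real (lam s)) has_vector_derivative L (of_real s)) (at s within J)"
    by (rule real_analytic_derivative_extension[OF assms t0]) (rule that)
  have "((\<lambda>s. complex_of_real (lam s)) has_vector_derivative L (of_real t0)) (at t0 within {0..T})"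
    by (rule d) (use t0 \<open>R > 0\<close> in auto)
  from has_vector_derivative_Re[OF this]
  show "continuous (at t0 within {0..T}) lam" by (auto dest: has_vector_derivative_continuous)
qed

text \<open>The candidate for the tip at time t: the point that the Loewner map sends to lam t in
  the limiting sense. A left limit is used because a flow has no admissible value at the collision
  time.\<close>

definition loewner_hits :: "(real \<Rightarrow> real) \<Rightarrow> complex \<Rightarrow> real \<Rightarrow> bool" where
  "loewner_hits lam z t \<longleftrightarrow> Im z > 0 \<and>
     (\<exists>h :: real \<Rightarrow> complex. h 0 = z \<and> loewner_flow lam h {0..<t} \<and> (h \<longlongrightarrow> lam t) (at_left t))"

text \<open>The intermediate time a is fixed slightly before t0 and serves all t near t0. Then t
  \<mapsto> sqrt (t - a), the local displacement \<open>F\<close> and the backward flow from a to 0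
  are composed; each is holomorphic on a complex neighbourhood, also when t0 = T.\<close>

lemma analytic_hitting_points:
  assumes "T > 0" and ana: "real_analytic_on lam {0..T}" and t0: "t0 \<in> {0<..T}"
  obtains Z \<epsilon> where "\<epsilon> > 0" "Z holomorphic_on ball (complex_of_real t0) \<epsilon>"
    and "\<And>t. t \<in> {0..T} \<Longrightarrow> \<bar>t - t0\<bar> < \<epsilon> \<Longrightarrow> loewner_hits lam (Z (of_real t)) t"
proof -
  have "t0 \<in> {0..T}" using t0 by auto
  then obtain R L M where "R > 0" and L: "L holomorphic_on ball (complex_of_real t0) R"
    and M: "\<And>z. z \<in> ball (complex_of_real t0) R \<Longrightarrow> cmod (L z) \<le> M"
    and d: "\<And>J s. \<lbrakk>J \<subseteq> {0..T}; s \<in> J; \<bar>s - t0\<bar> < R\<rbrakk> \<Longrightarrow>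
      ((\<lambda>s. complex_of_real (lam s)) has_vector_derivative L (of_real s)) (at s within J)"
    using real_analytic_derivative_extension[OF \<open>T > 0\<close> ana] by metis
  define N where "N = 1 / (4 * (\<bar>M\<bar> + 1))"
  have N: "N > 0" "N * M \<le> 1 / 4"
  proof -
    show "N > 0" by (simp add: N_def)
    have "M / (\<bar>M\<bar> + 1) \<le> 1" using abs_ge_self[of M] by (subst pos_divide_le_eq) simp_all
    then show "N * M \<le> 1 / 4" by (simp add: N_def divide_simps) linarith
  qed
  \<comment> \<open>The three bounds serve a = t0 - e: 4 e \<le> t0 keeps a nonnegative, 4 e \<le> R
    places the disc of radius 2 e about a inside the domain of \<open>L\<close>, and 2 e \<le> N^2
    gives \<beta> = sqrt (2 e) \<le> N, hence \<beta> M \<le> 1/4. The condition |t - t0| < e then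
    amounts to 0 < t - a < \<beta>^2.\<close>
  define e where "e = min (min R t0 / 4) (N\<^sup>2 / 2)"
  have e: "e > 0" "4 * e \<le> R" "4 * e \<le> t0" "2 * e \<le> N\<^sup>2"
    using \<open>R > 0\<close> t0 N by (auto simp: e_def min_def)
  define \<beta> where "\<beta> = sqrt (2 * e)"
  have \<beta>: "\<beta> > 0" "\<beta>\<^sup>2 = 2 * e" using e by (simp_all add: \<beta>_def)
  have "\<beta> \<le> N" unfolding \<beta>_def using e N by (intro real_le_lsqrt) auto
  define a where "a = t0 - e"
  have a: "0 \<le> a" "a < t0" "a \<le> T" using e t0 by (auto simp: a_def)
  have dist_a: "dist (complex_of_real t0) (of_real a) = e"
    using e by (simp add: dist_norm a_def flip: of_real_diff)
  have sub: "ball (complex_of_real a) (2 * e) \<subseteq> ball (complex_of_real t0) R"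
  proof
    fix z assume "z \<in> ball (complex_of_real a) (2 * e)"
    then have "dist (complex_of_real t0) z < e + 2 * e"
      using dist_triangle[of "complex_of_real t0" z "of_real a"] dist_a by auto
    then show "z \<in> ball (complex_of_real t0) R" using e by auto
  qed
  have M0: "M \<ge> 0"
    using M[of "complex_of_real t0"] \<open>R > 0\<close> norm_ge_zero[of "L (of_real t0)"] by (auto simp del: norm_ge_zero)
  have "\<beta> * M \<le> 1 / 4"
    using mult_right_mono[OF \<open>\<beta> \<le> N\<close> M0] N by linarith
  have M': "cmod (L z) \<le> M" if "z \<in> ball (complex_of_real a) (2 * e)" for z
    using M that sub by blast
  have \<beta>2: "\<beta>\<^sup>2 \<le> 2 * e" by (simp add: \<beta>)
  obtain F where F: "F holomorphic_on ball 0 \<beta>"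
    and flow: "\<And>b lam. \<lbrakk>0 < b; b < \<beta>;
        \<forall>s\<in>{a..a + b\<^sup>2}. ((\<lambda>s. complex_of_real (lam s)) has_vector_derivative L (of_real s))
          (at s within {a..a + b\<^sup>2})\<rbrakk> \<Longrightarrow>
      \<exists>h :: real \<Rightarrow> complex. loewner_flow lam h {a..<a + b\<^sup>2} \<and> (h \<longlongrightarrow> lam (a + b\<^sup>2)) (at_left (a + b\<^sup>2)) \<and>
        h a = lam a + F (of_real b) \<and> Im (F (of_real b)) \<ge> b"
    by (rule local_hitting_flow[OF holomorphic_on_subset[OF L sub] _ \<beta>(1) \<beta>2 \<open>\<beta> * M \<le> 1 / 4\<close>]; (rule M' | rule that))
  \<comment> \<open>At t0 the point at time a has imaginary part at least sqrt (t0 - a) = sqrt e.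
    Halving leaves a strict margin, so the height condition holds on a neighbourhood of t0.\<close>
  define \<delta> where "\<delta> = sqrt e / 2"
  have \<delta>: "\<delta> > 0" "\<delta> < sqrt e" using e by (auto simp: \<delta>_def)
  have lam: "continuous_on {0..a} lam"
    by (rule continuous_on_subset[OF real_analytic_imp_continuous[OF \<open>T > 0\<close> ana]]) (use a in auto)
  obtain f where f: "f holomorphic_on {z. Im z > \<delta>}"
    and pull: "\<And>z. Im z > \<delta> \<Longrightarrow> \<exists>h :: real \<Rightarrow> complex. loewner_flow lam h {0..a} \<and> h a = z \<and> h 0 = f z \<and> Im (f z) > 0"
    by (rule backward_flow[OF lam a(1) \<delta>(1)]) (rule that)
  define B where "B = ball (complex_of_real t0) e"
  define G where "G z = lam a + F (csqrt (z - of_real a))" for z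
  have B: "Re (z - of_real a) > 0" "csqrt (z - of_real a) \<in> ball 0 \<beta>" if "z \<in> B" for z
  proof -
    have z: "cmod (z - of_real t0) < e" using that by (simp add: B_def dist_norm norm_minus_commute)
    show "Re (z - of_real a) > 0"
      using abs_Re_le_cmod[of "z - of_real t0"] z by (simp add: a_def)
    have "cmod (z - of_real a) < 2 * e"
      using norm_triangle_ineq[of "z - of_real t0" "of_real t0 - of_real a"] z dist_a by (simp add: dist_norm)
    then have "cmod (csqrt (z - of_real a)) < \<beta>" by (simp add: \<beta>_def norm_csqrt)
    then show "csqrt (z - of_real a) \<in> ball 0 \<beta>" by simp
  qed
  have G: "G holomorphic_on B"
  proof -
    have "csqrt holomorphic_on (\<lambda>z. z - of_real a) ` B"
      by (rule holomorphic_on_csqrt[THEN holomorphic_on_subset]) (use B(1) in \<open>force simp: complex_nonpos_Reals_iff\<close>)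
    then have "(csqrt \<circ> (\<lambda>z. z - of_real a)) holomorphic_on B"
      by (rule holomorphic_on_compose[rotated]) (intro holomorphic_intros)
    then have "(F \<circ> (csqrt \<circ> (\<lambda>z. z - of_real a))) holomorphic_on B"
      by (rule holomorphic_on_compose) (rule holomorphic_on_subset[OF F], use B(2) in auto)
    then show ?thesis unfolding G_def o_def by (intro holomorphic_intros)
  qed
  have point: "Im (G (of_real t)) \<ge> sqrt (t - a) \<and> (\<exists>h :: real \<Rightarrow> complex. loewner_flow lam h {a..<t} \<and> (h \<longlongrightarrow> lam t) (at_left t) \<and> h a = G (of_real t))"
    if t: "t \<in> {0..T}" "\<bar>t - t0\<bar> < e" for t
  proof -
    define b where "b = sqrt (t - a)"
    have ta: "t - a > 0" "t - a < 2 * e" using t by (auto simp: a_def)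
    have b: "0 < b" "b < \<beta>" "a + b\<^sup>2 = t" using ta by (auto simp: b_def \<beta>_def)
    have der: "\<forall>s\<in>{a..a + b\<^sup>2}. ((\<lambda>s. complex_of_real (lam s)) has_vector_derivative L (of_real s))
        (at s within {a..a + b\<^sup>2})"
    proof
      fix s assume "s \<in> {a..a + b\<^sup>2}"
      then show "((\<lambda>s. complex_of_real (lam s)) has_vector_derivative L (of_real s)) (at s within {a..a + b\<^sup>2})"
        unfolding b(3) by (intro d) (use t a e in \<open>auto simp: a_def\<close>)
    qed
    obtain h where h: "loewner_flow lam h {a..<t}" "(h \<longlongrightarrow> complex_of_real (lam t)) (at_left t)"
      "h a = lam a + F (of_real b)" "Im (F (of_real b)) \<ge> b"
      using flow[OF b(1,2) der, unfolded b(3)] by (elim exE conjE)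
    have "csqrt (of_real t - of_real a) = of_real b"
      unfolding b_def of_real_sqrt[OF less_imp_le[OF ta(1)]] by simp
    then have "G (of_real t) = lam a + F (of_real b)" by (simp add: G_def)
    then show ?thesis using h by (auto simp: b_def)
  qed
  \<comment> \<open>The height estimate is available only for real t, whereas \<open>f\<close> must
    be composed with \<open>G\<close> on a complex disc. Continuity of \<open>G\<close> extends the
    condition from t0 to nearby complex arguments.\<close>
  define U where "U = {z \<in> B. Im (G z) > \<delta>}"
  have "continuous_on B (\<lambda>z. Im (G z))"
    by (intro continuous_intros holomorphic_on_imp_continuous_on G)
  then have "open (B \<inter> (\<lambda>z. Im (G z)) -` {\<delta><..})"
    by (rule continuous_open_preimage) (auto simp: B_def)
  moreover have "B \<inter> (\<lambda>z. Im (G z)) -` {\<delta><..} = U" by (auto simp: U_def)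
  ultimately have "open U" by simp
  moreover have "complex_of_real t0 \<in> U"
    using point[of t0] t0 e \<delta> by (auto simp: U_def B_def a_def)
  ultimately obtain \<epsilon> where \<epsilon>: "\<epsilon> > 0" "ball (complex_of_real t0) \<epsilon> \<subseteq> U" by (meson openE)
  show thesis
  proof (rule that[of \<epsilon> "f \<circ> G"])
    show "\<epsilon> > 0" by fact
    show "(f \<circ> G) holomorphic_on ball (complex_of_real t0) \<epsilon>"
      by (rule holomorphic_on_compose; rule holomorphic_on_subset[OF G] holomorphic_on_subset[OF f])
        (use \<epsilon> in \<open>auto simp: U_def\<close>)
    fix t assume t: "t \<in> {0..T}" "\<bar>t - t0\<bar> < \<epsilon>"
    then have "complex_of_real t \<in> ball (complex_of_real t0) \<epsilon>"
      by (simp add: dist_norm norm_minus_commute flip: of_real_diff)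
    then have tU: "complex_of_real t \<in> U" using \<epsilon> by blast
    then have te: "\<bar>t - t0\<bar> < e" by (simp add: U_def B_def dist_norm norm_minus_commute flip: of_real_diff)
    obtain k where k: "loewner_flow lam k {a..<t}" "(k \<longlongrightarrow> lam t) (at_left t)" "k a = G (of_real t)"
      using point[OF t(1) te] by blast
    obtain h where h: "loewner_flow lam h {0..a}" "h a = G (of_real t)" "h 0 = f (G (of_real t))" "Im (f (G (of_real t))) > 0"
      using pull[of "G (of_real t)"] tU by (auto simp: U_def)
    have at: "a < t" using te by (simp add: a_def)
    define w where "w = (\<lambda>s. if s \<in> {0..a} then h s else k s)"
    have "loewner_flow lam w {0..<t}"
      unfolding w_def by (rule loewner_flow_glue[OF h(1) k(1)]) (use h k a at in auto)
    moreover have "w 0 = f (G (of_real t))" using a h by (simp add: w_def)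
    moreover have "(w \<longlongrightarrow> lam t) (at_left t)"
    proof (rule Lim_transform_eventually[OF k(2)])
      show "\<forall>\<^sub>F s in at_left t. k s = w s"
        unfolding eventually_at_left_field by (intro exI[of _ a]) (use at in \<open>auto simp: w_def\<close>)
    qed
    ultimately show "loewner_hits lam ((f \<circ> G) (of_real t)) t"
      unfolding loewner_hits_def using h(4) by (auto simp: o_def)
  qed
qed

section \<open>Hitting points compared with the hulls and the curve\<close>

lemma hits_not_in_earlier_hull:
  assumes "loewner_hits lam z t" "0 \<le> s" "s < t"
  shows "z \<in> upper_half_plane - loewner_hull lam s"
proof -
  obtain h where h: "h 0 = z" "loewner_flow lam h {0..<t}" using assms by (auto simp: loewner_hits_def)
  have "loewner_flow lam h {0..s}" by (rule loewner_flow_subset[OF h(2)]) (use assms in auto)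
  then have "loewner_survives lam z s" unfolding loewner_survives_iff using h by blast
  then show ?thesis using assms by (auto simp: loewner_hull_def loewner_hits_def upper_half_plane_def)
qed

text \<open>A flow surviving to time t would coincide with the colliding one before t, and by
  continuity would equal lam t at time t, which a flow forbids.\<close>

lemma hits_in_hull:
  assumes "loewner_hits lam z t" "0 < t" and lam: "continuous_on {0..t} lam"
  shows "z \<in> loewner_hull lam t"
proof -
  obtain h where h: "h 0 = z" "loewner_flow lam h {0..<t}" "(h \<longlongrightarrow> lam t) (at_left t)"
    using assms by (auto simp: loewner_hits_def)
  have "\<not> loewner_survives lam z t"
  proof
    assume "loewner_survives lam z t"
    then obtain k where k: "k 0 = z" "loewner_flow lam k {0..t}" unfolding loewner_survives_iff by blast
    have "h s = k s" if s: "0 < s" "s < t" for s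
      by (rule loewner_flow_unique[where h = h and k = k and a = 0 and b = s and x = 0 and y = s])
        (use s h k in \<open>auto intro: loewner_flow_subset continuous_on_subset[OF lam]\<close>)
    then have "\<forall>\<^sub>F s in at_left t. h s = k s"
      unfolding eventually_at_left_field using \<open>0 < t\<close> by (intro exI[of _ 0]) auto
    from Lim_transform_eventually[OF h(3) this] have "(k \<longlongrightarrow> lam t) (at_left t)" .
    moreover have "(k \<longlongrightarrow> k t) (at_left t)"
      using loewner_flow_continuous[OF k(2)] \<open>0 < t\<close> at_within_Icc_at_left[OF \<open>0 < t\<close>]
      by (auto simp: continuous_on_def dest: bspec[of _ _ t])
    ultimately have "k t = lam t" using tendsto_unique[of "at_left t"] by fastforce
    then show False using k(2) \<open>0 < t\<close> by (auto simp: loewner_flow_def)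
  qed
  then show ?thesis using assms by (auto simp: loewner_hull_def loewner_hits_def upper_half_plane_def)
qed

text \<open>Absence from all earlier hulls gives a flow on the half-open interval. Since lam' is
  bounded on a short window before t, the flow could be continued to t unless it collides.\<close>

lemma swallowed_at_imp_hits:
  assumes "T > 0" and ana: "real_analytic_on lam {0..T}" and t: "t \<in> {0<..T}"
    and sw: "z \<in> loewner_hull lam t" "\<And>s. 0 \<le> s \<Longrightarrow> s < t \<Longrightarrow> z \<notin> loewner_hull lam s"
  shows "loewner_hits lam z t"
proof -
  have lam: "continuous_on {0..t} lam"
    by (rule continuous_on_subset[OF real_analytic_imp_continuous[OF assms(1,2)]]) (use t in auto)
  have z: "z \<in> upper_half_plane" "\<not> loewner_survives lam z t" using sw by (auto simp: loewner_hull_def)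
  obtain h where h: "h 0 = z" "loewner_flow lam h {0..<t}"
    by (rule survives_halfopen_flow[of t lam z])
      (use sw z t in \<open>auto simp: loewner_hull_def intro: continuous_on_subset[OF lam]\<close>)
  have "t \<in> {0..T}" using t by auto
  then obtain R L M where "R > 0"
    and M: "\<And>z. z \<in> ball (complex_of_real t) R \<Longrightarrow> cmod (L z) \<le> M"
    and d: "\<And>J s. \<lbrakk>J \<subseteq> {0..T}; s \<in> J; \<bar>s - t\<bar> < R\<rbrakk> \<Longrightarrow>
      ((\<lambda>s. complex_of_real (lam s)) has_vector_derivative L (of_real s)) (at s within J)"
    using real_analytic_derivative_extension[OF \<open>T > 0\<close> ana] by metis
  define a where "a = max 0 (t - R / 2)"
  have a: "0 \<le> a" "a < t" "t - a < R" using \<open>R > 0\<close> t by (auto simp: a_def)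
  have "(h \<longlongrightarrow> lam t) (at_left t)"
  proof (rule swallowed_imp_hits[OF h(2) a(1,2) lam])
    fix s assume s: "s \<in> {a..t}"
    show "((\<lambda>s. complex_of_real (lam s)) has_vector_derivative L (of_real s)) (at s within {a..t})"
      by (rule d) (use s a t in auto)
    show "cmod (L (of_real s)) \<le> M"
      by (rule M) (use s a in \<open>auto simp: dist_norm simp flip: of_real_diff\<close>)
  qed (use h z in simp)
  then show ?thesis using h z by (auto simp: loewner_hits_def upper_half_plane_def)
qed

lemma hits_unique:
  assumes "T > 0" and ana: "real_analytic_on lam {0..T}" and t: "t \<in> {0<..T}"
    and z: "loewner_hits lam z t" and w: "loewner_hits lam w t"
  shows "z = w"
proof -
  have lam: "continuous_on {0..t} lam"
    by (rule continuous_on_subset[OF real_analytic_imp_continuous[OF assms(1,2)]]) (use t in auto)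
  obtain h where h: "h 0 = z" "loewner_flow lam h {0..<t}" "(h \<longlongrightarrow> lam t) (at_left t)"
    using z by (auto simp: loewner_hits_def)
  obtain k where k: "k 0 = w" "loewner_flow lam k {0..<t}" "(k \<longlongrightarrow> lam t) (at_left t)"
    using w by (auto simp: loewner_hits_def)
  have "t \<in> {0..T}" using t by auto
  then obtain R L M where "R > 0"
    and M: "\<And>z. z \<in> ball (complex_of_real t) R \<Longrightarrow> cmod (L z) \<le> M"
    and d: "\<And>J s. \<lbrakk>J \<subseteq> {0..T}; s \<in> J; \<bar>s - t\<bar> < R\<rbrakk> \<Longrightarrow>
      ((\<lambda>s. complex_of_real (lam s)) has_vector_derivative L (of_real s)) (at s within J)"
    using real_analytic_derivative_extension[OF \<open>T > 0\<close> ana] by metis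
  define a where "a = max 0 (t - R / 2)"
  have a: "0 \<le> a" "a < t" "t - a < R" using \<open>R > 0\<close> t by (auto simp: a_def)
  have "h 0 = k 0"
  proof (rule hitting_flow_unique[OF h(2) k(2) _ _ a(1,2) lam _ _ h(3) k(3)])
    show "Im (h 0) > 0" "Im (k 0) > 0" using z w h k by (auto simp: loewner_hits_def)
    fix s assume s: "s \<in> {a..t}"
    show "((\<lambda>s. complex_of_real (lam s)) has_vector_derivative L (of_real s)) (at s within {a..t})"
      by (rule d) (use s a t in auto)
    show "cmod (L (of_real s)) \<le> M"
      by (rule M) (use s a in \<open>auto simp: dist_norm simp flip: of_real_diff\<close>)
  qed
  then show ?thesis using h k by simp
qed

text \<open>Finding a ball that avoids the curve requires a closed set, hence the image of
  \<open>{0..t}\<close> including time 0, while generation speaks only of \<open>{0<..s}\<close>.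
  This is where the alternative z = \<gamma> 0 comes from. Intermediate times are excluded because z
  still survives at every s < t and so lies off \<gamma> up to s.\<close>

lemma hitting_point_on_curve:
  assumes "T > 0" and ana: "real_analytic_on lam {0..T}" and gen: "loewner_generates lam T \<gamma>"
    and t: "t \<in> {0<..T}" and z: "loewner_hits lam z t"
  shows "z = \<gamma> t \<or> z = \<gamma> 0"
proof (rule ccontr)
  assume contr: "\<not> (z = \<gamma> t \<or> z = \<gamma> 0)"
  have lam: "continuous_on {0..t} lam"
    by (rule continuous_on_subset[OF real_analytic_imp_continuous[OF assms(1,2)]]) (use t in auto)
  have comp: "\<exists>w. upper_half_plane - loewner_hull lam s
          = connected_component_set (upper_half_plane - \<gamma> ` {0<..s}) w" if "s \<in> {0..T}" for s
    using gen that unfolding loewner_generates_def by blast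
  have early: "z \<in> upper_half_plane - loewner_hull lam s" if "0 \<le> s" "s < t" for s
    by (rule hits_not_in_earlier_hull[OF z that])
  have "z \<notin> \<gamma> ` {0<..s}" if s: "0 \<le> s" "s < t" for s
  proof -
    have "s \<in> {0..T}" using s t by auto
    then obtain w where w: "upper_half_plane - loewner_hull lam s
          = connected_component_set (upper_half_plane - \<gamma> ` {0<..s}) w" using comp by blast
    have "z \<in> connected_component_set (upper_half_plane - \<gamma> ` {0<..s}) w" using early[OF s] w by simp
    then show ?thesis using connected_component_subset by blast
  qed
  note avoid = this
  have "z \<notin> \<gamma> ` {0..t}"
  proof
    assume "z \<in> \<gamma> ` {0..t}"
    then obtain s where s: "0 \<le> s" "s \<le> t" "z = \<gamma> s" by auto
    then have "s \<noteq> 0" "s \<noteq> t" using contr by auto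
    then show False using avoid[of s] s by auto
  qed
  moreover have "closed (\<gamma> ` {0..t})"
  proof -
    have "continuous_on {0..T} \<gamma>" using gen by (simp add: loewner_generates_def)
    then have "continuous_on {0..t} \<gamma>" by (rule continuous_on_subset) (use t in auto)
    then show ?thesis by (intro compact_imp_closed compact_continuous_image) auto
  qed
  moreover have "open upper_half_plane"
    unfolding upper_half_plane_def by (rule open_halfspace_Im_gt)
  moreover have "z \<in> upper_half_plane" using z by (simp add: loewner_hits_def upper_half_plane_def)
  ultimately obtain r where r: "r > 0" "ball z r \<subseteq> upper_half_plane - \<gamma> ` {0..t}"
    using openE[of "upper_half_plane - \<gamma> ` {0..t}" z] by (auto simp: open_Diff)
  \<comment> \<open>The ball is connected and misses the curve up to time t, so it lies within one
    component for each s \<le> t. Survival to time s is therefore constant on the ball, and all its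
    points share the swallowing time of z.\<close>
  have same: "p \<in> upper_half_plane - loewner_hull lam s \<longleftrightarrow> z \<in> upper_half_plane - loewner_hull lam s"
    if s: "0 \<le> s" "s \<le> t" and p: "p \<in> ball z r" for s p
  proof -
    have "s \<in> {0..T}" using s t by auto
    then obtain w where w: "upper_half_plane - loewner_hull lam s
          = connected_component_set (upper_half_plane - \<gamma> ` {0<..s}) w" using comp by blast
    have "ball z r \<subseteq> upper_half_plane - \<gamma> ` {0<..s}" using r s by force
    then have "connected_component (upper_half_plane - \<gamma> ` {0<..s}) p z"
      unfolding connected_component_def by (intro exI[of _ "ball z r"]) (use p r in auto)
    then show ?thesis
      unfolding w mem_Collect_eq by (metis connected_component_sym connected_component_trans)
  qed
  have zt: "z \<in> loewner_hull lam t" by (rule hits_in_hull[OF z _ lam]) (use t in auto)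
  have all: "p = z" if p: "p \<in> ball z r" for p
  proof (rule hits_unique[OF assms(1,2) t _ z], rule swallowed_at_imp_hits[OF assms(1,2) t])
    have "p \<in> upper_half_plane" using p r by auto
    then show "p \<in> loewner_hull lam t" using same[of t p] p zt t by auto
    fix s assume "0 \<le> s" "s < t"
    then show "p \<notin> loewner_hull lam s" using same[of s p] p early[of s] by auto
  qed
  have "z + of_real (r / 2) \<in> ball z r" using r by (simp add: dist_norm)
  from all[OF this] show False using r by simp
qed

text \<open>
  The value of the curve at time 0 is unconstrained by the generation condition, so z = \<gamma>(0) has to be
  excluded: it would put \<gamma>(0) in the half-plane although the hitting points at small times s
  have imaginary part at most 2 sqrt s.
\<close>
lemma hits_imp_eq_curve:
  assumes "T > 0" and ana: "real_analytic_on lam {0..T}" and gen: "loewner_generates lam T \<gamma>"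
    and t: "t \<in> {0<..T}" and z: "loewner_hits lam z t"
  shows "z = \<gamma> t"
proof (rule ccontr)
  assume "z \<noteq> \<gamma> t"
  then have z0: "z = \<gamma> 0" using hitting_point_on_curve[OF assms] by blast
  have ex: "\<exists>w. loewner_hits lam w s" if s: "s \<in> {0<..T}" for s
  proof -
    obtain Z \<epsilon> where "\<epsilon> > 0"
      and Z: "\<And>t. t \<in> {0..T} \<Longrightarrow> \<bar>t - s\<bar> < \<epsilon> \<Longrightarrow> loewner_hits lam (Z (complex_of_real t)) t"
      using analytic_hitting_points[OF assms(1,2) s] by metis
    then show ?thesis using Z[of s] s \<open>\<epsilon> > 0\<close> by (intro exI[of _ "Z (of_real s)"]) auto
  qed
  have small: "(Im (\<gamma> s))\<^sup>2 \<le> 4 * s" if s: "0 < s" "s < t" for s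
  proof -
    have sT: "s \<in> {0<..T}" using s t by auto
    then obtain w where w: "loewner_hits lam w s" using ex by blast
    \<comment> \<open>A point hits at most once: z collides at t, so it has not been swallowed by
      the earlier time s. Being different from z = \<gamma> 0, the hitting point at time s must be
      \<gamma> s.\<close>
    have "w \<noteq> z"
    proof
      assume "w = z"
      have "continuous_on {0..s} lam"
        by (rule continuous_on_subset[OF real_analytic_imp_continuous[OF assms(1,2)]]) (use sT in auto)
      then have "z \<in> loewner_hull lam s" using hits_in_hull[of lam w s] w s \<open>w = z\<close> by auto
      then show False using hits_not_in_earlier_hull[OF z, of s] s by auto
    qed
    then have "w = \<gamma> s" using hitting_point_on_curve[OF assms(1-3) sT w] z0 by blast
    moreover obtain h where "h 0 = w" "loewner_flow lam h {0..<s}" "(h \<longlongrightarrow> lam s) (at_left s)"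
      using w by (auto simp: loewner_hits_def)
    ultimately show ?thesis using hitting_flow_Im_bound[of lam h s] s by simp
  qed
  have "(\<gamma> \<longlongrightarrow> \<gamma> 0) (at 0 within {0..T})"
    using gen \<open>T > 0\<close> by (auto simp: loewner_generates_def continuous_on_def)
  then have "(\<gamma> \<longlongrightarrow> \<gamma> 0) (at_right 0)" using at_within_Icc_at_right[OF \<open>T > 0\<close>] by metis
  then have "((\<lambda>s. (Im (\<gamma> s))\<^sup>2) \<longlongrightarrow> (Im (\<gamma> 0))\<^sup>2) (at_right 0)" by (intro tendsto_intros)
  moreover have "((\<lambda>s. 4 * s) \<longlongrightarrow> 4 * (0::real)) (at_right 0)" by (intro tendsto_intros)
  moreover have "\<forall>\<^sub>F s in at_right 0. (Im (\<gamma> s))\<^sup>2 \<le> 4 * s"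
    unfolding eventually_at_right_field using small t by (intro exI[of _ t]) auto
  ultimately have "(Im (\<gamma> 0))\<^sup>2 \<le> 4 * 0" by (intro tendsto_le[of "at_right 0"]) auto
  then have "Im (\<gamma> 0) = 0" by simp
  then show False using z z0 by (simp add: loewner_hits_def)
qed

theorem theorem1p2:
  fixes T :: real and lam :: "real \<Rightarrow> real" and \<gamma> :: "real \<Rightarrow> complex"
  assumes "T > 0"
    and "real_analytic_on lam {0..T}"
    and "loewner_generates lam T \<gamma>"
  shows "real_analytic_on \<gamma> {0<..T}"
  unfolding real_analytic_on_def
proof
  fix t0 assume t0: "t0 \<in> {0<..T}"
  obtain Z \<epsilon> where \<epsilon>: "\<epsilon> > 0" and Z: "Z holomorphic_on ball (complex_of_real t0) \<epsilon>"
    and hits: "\<And>t. t \<in> {0..T} \<Longrightarrow> \<bar>t - t0\<bar> < \<epsilon> \<Longrightarrow> loewner_hits lam (Z (of_real t)) t"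
    using analytic_hitting_points[OF assms(1,2) t0] by metis
  \<comment> \<open>Taylor coefficients of \<open>Z\<close> at t0. The expansion holds on the whole
    complex disc, so it also covers the one-sided neighbourhood at t0 = T.\<close>
  define c where "c n = (deriv ^^ n) Z (of_real t0) / fact n" for n
  have "(\<lambda>n. ((y - t0) ^ n) *\<^sub>R c n) sums \<gamma> y" if y: "y \<in> {0<..T}" "\<bar>y - t0\<bar> < \<epsilon>" for y
  proof -
    have "complex_of_real y \<in> ball (of_real t0) \<epsilon>"
      using y by (simp add: dist_norm norm_minus_commute flip: of_real_diff)
    from holomorphic_power_series[OF Z this]
    have "(\<lambda>n. c n * of_real ((y - t0) ^ n)) sums Z (of_real y)" by (simp add: c_def)
    moreover have "Z (of_real y) = \<gamma> y"
      by (rule hits_imp_eq_curve[OF assms y(1)]) (use hits y in auto)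
    ultimately show ?thesis by (simp add: scaleR_conv_of_real mult.commute)
  qed
  then show "\<exists>r>0. \<exists>c. \<forall>y\<in>{0<..T}. \<bar>y - t0\<bar> < r \<longrightarrow> (\<lambda>n. ((y - t0) ^ n) *\<^sub>R c n) sums \<gamma> y"
    using \<epsilon> by blast
qed

end
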